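(* Let $N\ge1$ and let $\Omega\subset\mathbb{R}^N$ be a bounded domain with smooth boundary $\Gamma$ such that $0\in\Gamma$. Then, for any $\mu\le\mu_N:=N^2/4$ and any $0\le\gamma<2$, there exist two constants $C_2$ and $C_3>0$ depending on $\gamma,\mu$ and $\Omega$ such that $$C_2\int_\Omega u^2\,dx+\int_\Omega\Big(|\nabla u|^2-\mu\frac{u^2}{|x|^2}\Big)dx\ \ge\ C_3\int_\Omega\Big(|x|^{2-\gamma}|\nabla u|^2+\frac{u^2}{|x|^\gamma}\Big)dx,\qquad\forall u\in H_0^1(\Omega).$$ *)

theory Defs
  imports "HOL-Analysis.Analysis"
begin

primrec Ck :: "nat \<Rightarrow> ('a::euclidean_space \<Rightarrow> real) \<Rightarrow> bool" where
  "Ck 0 f \<longleftrightarrow> continuous_on UNIV f"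
| "Ck (Suc k) f \<longleftrightarrow>
     f differentiable_on UNIV \<and> (\<forall>v. Ck k (\<lambda>x. frechet_derivative f (at x) v))"

definition smooth :: "('a::euclidean_space \<Rightarrow> real) \<Rightarrow> bool" where
  "smooth f \<longleftrightarrow> (\<forall>k. Ck k f)"

text \<open>Near each boundary point the domain is, in suitable orthonormal coordinates, the strict
  epigraph of a \<open>C\<^sup>\<infinity>\<close> function of the remaining \<open>N - 1\<close> variables. The unit vector \<open>e\<close> is the
  direction of the last coordinate. The remaining coordinates are encoded by the orthogonal
  projection \<open>x - (x \<bullet> e) e\<close>, so only the values of \<open>h\<close> on the hyperplane orthogonal to \<open>e\<close>
  matter.\<close>

definition smooth_boundary :: "'a::euclidean_space set \<Rightarrow> bool" where
  "smooth_boundary \<Omega> \<longleftrightarrow>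
     (\<forall>p\<in>frontier \<Omega>. \<exists>r>0. \<exists>e h. norm e = 1 \<and> smooth h \<and>
        \<Omega> \<inter> ball p r = {x \<in> ball p r. h (x - (x \<bullet> e) *\<^sub>R e) < x \<bullet> e})"

definition test_functions :: "'a::euclidean_space set \<Rightarrow> ('a \<Rightarrow> real) set" where
  "test_functions \<Omega> =
     {\<phi>. smooth \<phi> \<and> compact (closure {x. \<phi> x \<noteq> 0}) \<and> closure {x. \<phi> x \<noteq> 0} \<subseteq> \<Omega>}"

definition gradient :: "('a::euclidean_space \<Rightarrow> real) \<Rightarrow> 'a \<Rightarrow> 'a" where
  "gradient f x = (\<Sum>i\<in>Basis. frechet_derivative f (at x) i *\<^sub>R i)"

definition L2 :: "'a::euclidean_space set \<Rightarrow> ('a \<Rightarrow> 'b::euclidean_space) set" where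
  "L2 \<Omega> = {f \<in> borel_measurable (lebesgue_on \<Omega>). integrable (lebesgue_on \<Omega>) (\<lambda>x. (norm (f x))\<^sup>2)}"

definition locally_integrable :: "'a::euclidean_space set \<Rightarrow> ('a \<Rightarrow> 'b::euclidean_space) \<Rightarrow> bool" where
  "locally_integrable \<Omega> f \<longleftrightarrow>
     (\<forall>K. compact K \<and> K \<subseteq> \<Omega> \<longrightarrow> integrable (lebesgue_on K) f)"

text \<open>Functions on \<open>\<Omega>\<close> are represented by total functions whose values outside \<open>\<Omega>\<close> are irrelevant.
  Equality almost everywhere is not factored out, hence the weak gradient is a relation.\<close>

definition has_weak_gradient ::
  "'a::euclidean_space set \<Rightarrow> ('a \<Rightarrow> real) \<Rightarrow> ('a \<Rightarrow> 'a) \<Rightarrow> bool" where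
  "has_weak_gradient \<Omega> u g \<longleftrightarrow>
     locally_integrable \<Omega> u \<and> locally_integrable \<Omega> g \<and>
     (\<forall>\<phi>\<in>test_functions \<Omega>. \<forall>i\<in>Basis.
        (LINT x|lebesgue_on \<Omega>. u x * frechet_derivative \<phi> (at x) i) =
        - (LINT x|lebesgue_on \<Omega>. (g x \<bullet> i) * \<phi> x))"

definition H1 :: "'a::euclidean_space set \<Rightarrow> ('a \<Rightarrow> real) set" where
  "H1 \<Omega> = {u \<in> L2 \<Omega>. \<exists>g\<in>L2 \<Omega>. has_weak_gradient \<Omega> u g}"

text \<open>The closure of the test functions in \<open>H\<^sup>1(\<Omega>)\<close>.\<close>

definition H10 :: "'a::euclidean_space set \<Rightarrow> ('a \<Rightarrow> real) set" where
  "H10 \<Omega> = {u \<in> H1 \<Omega>. \<exists>g\<in>L2 \<Omega>. has_weak_gradient \<Omega> u g \<and>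
     (\<exists>\<phi>. (\<forall>n. \<phi> n \<in> test_functions \<Omega>) \<and>
       (\<lambda>n. LINT x|lebesgue_on \<Omega>. (\<phi> n x - u x)\<^sup>2 + (norm (gradient (\<phi> n) x - g x))\<^sup>2)
         \<longlonglongrightarrow> 0)}"

end

theory Submission
  imports Defs
begin

text \<open>A vector field \<open>G\<close> and a weight \<open>w > 0\<close> with \<open>div G - |G|\<^sup>2 / w \<ge> V\<close> give
  \<open>\<integral> w |\<nabla>\<phi>|\<^sup>2 \<ge> \<integral> V \<phi>\<^sup>2\<close> for test functions \<open>\<phi>\<close>, by integrating
  \<open>w |\<nabla>\<phi> + \<phi> G / w|\<^sup>2 \<ge> 0\<close>. Near the origin one takes \<open>G = - w \<chi> \<nabla>\<psi> / \<psi>\<close>. Here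
  \<open>\<psi> = \<delta> exp (- K \<delta>) |x| powr (- N / 2) exp (- |x| powr \<epsilon> / \<epsilon>)\<close> with \<open>\<delta>\<close> a smooth
  boundary defining function. The factor \<open>\<delta> |x| powr (- N / 2)\<close> is the ground state of the
  half-space and produces the constant \<open>N\<^sup>2 / 4\<close>. The factor \<open>exp (- K \<delta>)\<close> yields a term of size
  \<open>K / \<delta>\<close>, which absorbs the curvature of the boundary. The last factor yields the gain
  \<open>|x| powr (\<epsilon> - 2)\<close>, part of which pays for the weight \<open>w = 1 - c |x| powr \<epsilon>\<close>. That weight is
  what produces the gradient term on the right-hand side. The cutoff \<open>\<chi> = (1 - |x|\<^sup>2 / R\<^sup>2)\<^sup>2\<close> only costs
  a bounded potential, because \<open>1 - \<chi> = O(|x|\<^sup>2)\<close> and \<open>|\<nabla>\<chi>|\<^sup>2\<close> is bounded by a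
  multiple of \<open>\<chi> (1 - \<chi>)\<close>.\<close>

section \<open>Vector fields and weighted inequalities\<close>

text \<open>The half-space model explains the constant: \<psi> = x_N |x|^s satisfies \<Delta>\<psi>
  = s (s + N) |x|^(-2) \<psi>, and s (s + N) has its minimum -N^2/4 at s = -N/2. The factor x_N,
  forced by the boundary condition, is what raises the interior value (N - 2)^2/4 to N^2/4. At this
  minimum there is no slack in the leading order, so every error caused by bending the boundary has
  to be paid by a lower-order gain. Errors of order 1/\<delta> are charged to K/\<delta>. The factor
  exp (-K \<delta>) in turn creates an error of order K/|x|, and near the origin only a gain
  |x|^(\<epsilon> - 2) with \<epsilon> < 1 beats it. Away from the origin the potential is bounded,
  so the boundary has to be described near 0 only. The field blows up like 1/\<delta> at the
  boundary, but it is tested against functions with compact support in \<Omega>, so no boundary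
  terms arise.\<close>

lemma integral_lborel_shift:
  fixes f :: "'a::euclidean_space \<Rightarrow> real"
  assumes "f \<in> borel_measurable borel"
  shows "(LINT x|lborel. f (x + c)) = (LINT x|lborel. f x)"
proof -
  have "(LINT x|lborel. f x) = (LINT x|distr lborel borel ((+) c). f x)"
    by (simp add: lborel_distr_plus)
  also have "\<dots> = (LINT x|lborel. f (c + x))"
    by (rule integral_distr) (use assms in auto)
  finally show ?thesis by (simp add: add.commute)
qed

lemma integrable_lborel_continuous_compact:
  fixes f :: "'a::euclidean_space \<Rightarrow> real"
  assumes "continuous_on UNIV f" "compact K" "\<And>x. x \<notin> K \<Longrightarrow> f x = 0"
  shows "integrable lborel f"
proof -
  have "integrable lborel (\<lambda>x. indicator K x *\<^sub>R f x)"
    by (rule borel_integrable_compact[OF assms(2) continuous_on_subset[OF assms(1)]]) simp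
  moreover have "indicator K x *\<^sub>R f x = f x" for x
    using assms(3) by (cases "x \<in> K") auto
  ultimately show ?thesis by (simp only:)
qed

text \<open>Translation invariance makes every difference quotient of \<open>g\<close> integrate to
  zero, and dominated convergence hands this on to the derivative.\<close>

lemma integral_directional_derivative_eq_0:
  fixes g g' :: "'a::euclidean_space \<Rightarrow> real"
  assumes K: "compact K"
    and g: "\<And>x. x \<notin> K \<Longrightarrow> g x = 0" and g': "\<And>x. x \<notin> K \<Longrightarrow> g' x = 0"
    and cg: "continuous_on UNIV g" and cg': "continuous_on UNIV g'"
    and D: "\<And>x. ((\<lambda>t. g (x + t *\<^sub>R v)) has_real_derivative g' x) (at 0)"
  shows "(LINT x|lborel. g' x) = 0"
proof -
  obtain B where B: "\<And>x. \<bar>g' x\<bar> \<le> B" "B \<ge> 0"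
  proof -
    have "bounded (g' ` K)"
      by (intro compact_imp_bounded compact_continuous_image continuous_on_subset[OF cg'] K) auto
    then obtain B where "B > 0" "\<forall>x\<in>K. \<bar>g' x\<bar> \<le> B"
      by (auto simp: bounded_pos)
    then have "\<bar>g' x\<bar> \<le> B" for x by (cases "x \<in> K") (auto simp: g')
    then show ?thesis using that[of B] \<open>B > 0\<close> by simp
  qed
  obtain r where r: "K \<subseteq> cball 0 r"
    using compact_imp_bounded[OF K] by (auto simp: bounded_iff subset_iff)
  have mg: "g \<in> borel_measurable borel" and mg': "g' \<in> borel_measurable borel"
    using cg cg' by (auto intro: borel_measurable_continuous_onI)
  have ig: "integrable lborel g"
    using integrable_lborel_continuous_compact[OF cg K g] .
  have D': "((\<lambda>t. g (x + t *\<^sub>R v)) has_real_derivative g' (x + s *\<^sub>R v)) (at s)" for x s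
  proof -
    have "((\<lambda>t. g ((x + s *\<^sub>R v) + t *\<^sub>R v)) has_real_derivative g' (x + s *\<^sub>R v)) (at (s + - s))"
      using D[of "x + s *\<^sub>R v"] by simp
    then have "((\<lambda>t. g ((x + s *\<^sub>R v) + (t + - s) *\<^sub>R v)) has_real_derivative g' (x + s *\<^sub>R v)) (at s)"
      by (rule DERIV_shift[THEN iffD1])
    then show ?thesis by (simp add: algebra_simps)
  qed
  define h where "h = (\<lambda>n. inverse (real (Suc n)))"
  have h: "h n > 0" "h n \<le> 1" for n by (auto simp: h_def field_simps)
  have hlim: "h \<longlonglongrightarrow> 0" unfolding h_def by (rule LIMSEQ_inverse_real_of_nat)
  define s where "s = (\<lambda>n x. (g (x + h n *\<^sub>R v) - g x) / h n)"
  have "(\<lambda>n. LINT x|lborel. s n x) \<longlonglongrightarrow> (LINT x|lborel. g' x)"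
  proof (rule integral_dominated_convergence)
    show "g' \<in> borel_measurable lborel" using mg' by simp
    show "s n \<in> borel_measurable lborel" for n
      unfolding s_def using mg by measurable
    \<comment> \<open>The increments are at most 1, so all translated supports lie in one ball of
      radius \<open>r + norm v\<close>; the mean value theorem bounds the quotients by
      \<open>B\<close>.\<close>
    show "integrable lborel (\<lambda>x::'a. B * indicator (cball 0 (r + norm v)) x)"
      by (intro integrable_mult_right)
         (use emeasure_bounded_finite[OF bounded_cball, of "0::'a" "r + norm v"] in
          \<open>simp add: integrable_indicator_iff\<close>)
    show "AE x in lborel. (\<lambda>n. s n x) \<longlonglongrightarrow> g' x"
    proof (rule AE_I2)
      fix x :: 'a
      have "((\<lambda>t. (g (x + t *\<^sub>R v) - g x) / t) \<longlongrightarrow> g' x) (at 0)"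
        using D[of x] by (simp add: DERIV_def)
      moreover have "filterlim h (at 0) sequentially"
        using hlim h(1) by (intro filterlim_atI always_eventually) (auto simp: less_le)
      ultimately show "(\<lambda>n. s n x) \<longlonglongrightarrow> g' x"
        unfolding s_def by (rule filterlim_compose)
    qed
    show "AE x in lborel. norm (s n x) \<le> B * indicator (cball 0 (r + norm v)) x" for n
    proof (rule AE_I2)
      fix x :: 'a
      show "norm (s n x) \<le> B * indicator (cball 0 (r + norm v)) x"
      proof (cases "x \<in> cball 0 (r + norm v)")
        case False
        then have nx: "norm x > r + norm v" by simp
        have "norm (h n *\<^sub>R v) \<le> norm v"
          using h[of n] by (simp add: mult_left_le_one_le)
        moreover have "norm x \<le> norm (x + h n *\<^sub>R v) + norm (h n *\<^sub>R v)"
          by (metis add_diff_cancel_right' norm_triangle_ineq4)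
        ultimately have "norm (x + h n *\<^sub>R v) > r" using nx by linarith
        moreover have "norm x > r" using nx norm_ge_zero[of v] by linarith
        ultimately have "x \<notin> K" "x + h n *\<^sub>R v \<notin> K" using r by (auto simp: subset_iff)
        then show ?thesis using B by (simp add: s_def g)
      next
        case True
        obtain z where "g (x + h n *\<^sub>R v) - g (x + 0 *\<^sub>R v) = (h n - 0) * g' (x + z *\<^sub>R v)"
          using MVT2[OF h(1)[of n], of "\<lambda>t. g (x + t *\<^sub>R v)" "\<lambda>t. g' (x + t *\<^sub>R v)"] D' by blast
        then have "s n x = g' (x + z *\<^sub>R v)" using h(1)[of n] by (simp add: s_def)
        then show ?thesis using True B by simp
      qed
    qed
  qed
  moreover have "(LINT x|lborel. s n x) = 0" for n
  proof -
    have sh: "(LINT x|lborel. g (x + h n *\<^sub>R v)) = (LINT x|lborel. g x)"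
      by (rule integral_lborel_shift[OF mg])
    have "integrable (distr lborel borel ((+) (h n *\<^sub>R v))) g"
      using ig by (simp add: lborel_distr_plus)
    then have "integrable lborel (\<lambda>x. g (x + h n *\<^sub>R v))"
      using mg by (subst (asm) integrable_distr_eq) (auto simp: add.commute)
    then show ?thesis using ig sh by (simp add: s_def)
  qed
  ultimately show ?thesis using LIMSEQ_unique[of "\<lambda>n. 0::real"] by simp
qed

section \<open>Gradients and supports of test functions\<close>

lemma smooth_imp_differentiable:
  assumes "smooth \<phi>" shows "\<phi> differentiable at x"
  using assms by (metis Ck.simps(2) UNIV_I differentiable_on_def smooth_def)

lemma smooth_imp_continuous_frechet:
  assumes "smooth \<phi>" shows "continuous_on UNIV (\<lambda>x. frechet_derivative \<phi> (at x) v)"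
  using assms by (metis Ck.simps One_nat_def smooth_def)

lemma frechet_eq_gradient:
  assumes "\<phi> differentiable at x"
  shows "frechet_derivative \<phi> (at x) v = gradient \<phi> x \<bullet> v"
proof -
  have lin: "linear (frechet_derivative \<phi> (at x))"
    using assms linear_frechet_derivative by blast
  have "frechet_derivative \<phi> (at x) v = frechet_derivative \<phi> (at x) (\<Sum>i\<in>Basis. (v \<bullet> i) *\<^sub>R i)"
    by (simp add: euclidean_representation)
  also have "\<dots> = (\<Sum>i\<in>Basis. (v \<bullet> i) * frechet_derivative \<phi> (at x) i)"
    by (simp add: linear_sum[OF lin] linear_scale[OF lin])
  also have "\<dots> = gradient \<phi> x \<bullet> v"
    by (simp add: gradient_def inner_sum_left inner_sum_right inner_commute[of _ v] mult.commute)
  finally show ?thesis .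
qed

lemma smooth_has_gradient:
  assumes "smooth \<phi>" shows "(\<phi> has_derivative (\<lambda>v. gradient \<phi> x \<bullet> v)) (at x)"
proof -
  have "(\<phi> has_derivative frechet_derivative \<phi> (at x)) (at x)"
    using smooth_imp_differentiable[OF assms] frechet_derivative_works by blast
  moreover have "frechet_derivative \<phi> (at x) = (\<lambda>v. gradient \<phi> x \<bullet> v)"
    using frechet_eq_gradient[OF smooth_imp_differentiable[OF assms, of x]] by blast
  ultimately show ?thesis by simp
qed

lemma smooth_continuous_gradient:
  assumes "smooth \<phi>" shows "continuous_on UNIV (gradient \<phi>)"
  unfolding gradient_def[abs_def]
  by (intro continuous_intros smooth_imp_continuous_frechet assms)

lemma smooth_continuous: assumes "smooth \<phi>" shows "continuous_on UNIV \<phi>"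
  using assms Ck.simps(1) smooth_def by blast

lemma test_functions_smooth: "\<phi> \<in> test_functions \<Omega> \<Longrightarrow> smooth \<phi>"
  by (simp add: test_functions_def)

definition supp :: "('a::euclidean_space \<Rightarrow> real) \<Rightarrow> 'a set" where
  "supp \<phi> = closure {x. \<phi> x \<noteq> 0}"

lemma open_supp: "open (- supp \<phi>)"
  by (simp add: supp_def open_Compl)

lemma test_functions_supp:
  assumes "\<phi> \<in> test_functions \<Omega>"
  shows "compact (supp \<phi>)" "supp \<phi> \<subseteq> \<Omega>" "\<And>x. x \<notin> supp \<phi> \<Longrightarrow> \<phi> x = 0"
  using assms closure_subset[of "{x. \<phi> x \<noteq> 0}"] by (auto simp: test_functions_def supp_def)

lemma gradient_outside_supp:
  assumes "smooth \<phi>" "x \<notin> supp \<phi>" shows "gradient \<phi> x = 0"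
proof -
  have "open (- supp \<phi>)" "x \<in> - supp \<phi>" using assms by (auto simp: supp_def)
  moreover have "((\<lambda>_. 0) has_derivative (\<lambda>v. 0)) (at x)" by simp
  moreover have "0 = \<phi> y" if "y \<in> - supp \<phi>" for y
    using that closure_subset[of "{x. \<phi> x \<noteq> 0}"] by (auto simp: supp_def)
  ultimately have "(\<phi> has_derivative (\<lambda>v. 0)) (at x)"
    using has_derivative_transform_within_open by blast
  then have "(\<lambda>v. gradient \<phi> x \<bullet> v) = (\<lambda>v. 0)"
    using smooth_has_gradient[OF assms(1)] has_derivative_unique by blast
  then have "gradient \<phi> x \<bullet> gradient \<phi> x = 0" by metis
  then show ?thesis by simp
qed

section \<open>The divergence theorem against test functions\<close>

text \<open>The trace of a linear map. Applied to the derivative at a point it is the divergence of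
  the field there.\<close>

definition divergence :: "('a::euclidean_space \<Rightarrow> 'a) \<Rightarrow> real" where
  "divergence L = (\<Sum>i\<in>Basis. L i \<bullet> i)"

text \<open>\<Omega> and the complement of the support form an open cover of the space, and the
  function vanishes on the second set. This admits coefficients that are singular at the boundary of
  \<Omega>.\<close>

lemma continuous_on_mult_test:
  fixes f :: "'a::euclidean_space \<Rightarrow> real"
  assumes "\<phi> \<in> test_functions \<Omega>" "open \<Omega>" "continuous_on \<Omega> f" "\<And>x. x \<notin> supp \<phi> \<Longrightarrow> f x = 0"
  shows "continuous_on UNIV f"
proof -
  have "continuous_on (- supp \<phi>) f"
    by (subst continuous_on_cong[OF refl, of _ _ "\<lambda>_. 0"]) (use assms in auto)
  moreover have "open (- supp \<phi>)" by (simp add: supp_def open_Compl)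
  ultimately have "continuous_on (\<Omega> \<union> - supp \<phi>) f"
    using assms by (intro continuous_on_open_Un)
  moreover have "\<Omega> \<union> - supp \<phi> = UNIV" using test_functions_supp(2)[OF assms(1)] by auto
  ultimately show ?thesis by simp
qed

text \<open>The integrand is the divergence of \<phi>^2 G, a compactly supported field that is C^1
  on the whole space even if G is singular at the boundary. Each coordinate contributes one
  directional derivative with integral zero.\<close>

lemma integral_divergence_test:
  fixes G :: "'a::euclidean_space \<Rightarrow> 'a"
  assumes \<phi>: "\<phi> \<in> test_functions \<Omega>" and op: "open \<Omega>"
    and G: "\<And>x. x \<in> \<Omega> \<Longrightarrow> (G has_derivative G' x) (at x)"
    and cG: "\<And>i. i \<in> Basis \<Longrightarrow> continuous_on \<Omega> (\<lambda>x. G' x i)"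
  shows "integrable lborel (\<lambda>x. 2 * \<phi> x * (gradient \<phi> x \<bullet> G x) + (\<phi> x)\<^sup>2 * divergence (G' x))"
    and "(LINT x|lborel. 2 * \<phi> x * (gradient \<phi> x \<bullet> G x) + (\<phi> x)\<^sup>2 * divergence (G' x)) = 0"
proof -
  note sm = test_functions_smooth[OF \<phi>]
  note su = test_functions_supp[OF \<phi>]
  have GC: "continuous_on \<Omega> G"
    using G has_derivative_continuous continuous_at_imp_continuous_on by blast
  have pC: "continuous_on \<Omega> \<phi>" "continuous_on \<Omega> (gradient \<phi>)"
    using smooth_continuous[OF sm] smooth_continuous_gradient[OF sm] continuous_on_subset by blast+
  define d where "d = (\<lambda>i x. 2 * \<phi> x * (gradient \<phi> x \<bullet> i) * (G x \<bullet> i) + (\<phi> x)\<^sup>2 * (G' x i \<bullet> i))"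
  have dc: "continuous_on UNIV (d i)" if "i \<in> Basis" for i
    unfolding d_def
    by (rule continuous_on_mult_test[OF \<phi> op])
       (auto intro!: continuous_intros GC pC cG that simp: su(3))
  have dz: "d i x = 0" if "x \<notin> supp \<phi>" for i x
    using that by (simp add: d_def su(3))
  have di: "integrable lborel (d i)" if "i \<in> Basis" for i
    using integrable_lborel_continuous_compact[OF dc[OF that] su(1)] dz by blast
  have d0: "(LINT x|lborel. d i x) = 0" if i: "i \<in> Basis" for i
  proof (rule integral_directional_derivative_eq_0[OF su(1), where g="\<lambda>x. (\<phi> x)\<^sup>2 * (G x \<bullet> i)" and v=i])
    show "continuous_on UNIV (\<lambda>x. (\<phi> x)\<^sup>2 * (G x \<bullet> i))"
      by (rule continuous_on_mult_test[OF \<phi> op])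
         (auto intro!: continuous_intros GC pC simp: su(3))
    show "((\<lambda>t. (\<phi> (x + t *\<^sub>R i))\<^sup>2 * (G (x + t *\<^sub>R i) \<bullet> i)) has_real_derivative d i x) (at 0)" for x
    proof -
      have "((\<lambda>x. (\<phi> x)\<^sup>2 * (G x \<bullet> i)) has_derivative
          (\<lambda>v. 2 * \<phi> x * (gradient \<phi> x \<bullet> v) * (G x \<bullet> i) + (\<phi> x)\<^sup>2 * (G' x v \<bullet> i))) (at x)"
      proof (cases "x \<in> \<Omega>")
        case True
        show ?thesis
          using has_derivative_mult[OF has_derivative_power[OF smooth_has_gradient[OF sm], of 2]
              has_derivative_inner_left[OF G[OF True], of i]]
          by (simp add: algebra_simps)
      next
        case False
        have *: "open (- supp \<phi>)" "x \<in> - supp \<phi>" using su(2) False by (auto simp: open_supp)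
        have "((\<lambda>_. 0) has_derivative
          (\<lambda>v. 2 * \<phi> x * (gradient \<phi> x \<bullet> v) * (G x \<bullet> i) + (\<phi> x)\<^sup>2 * (G' x v \<bullet> i))) (at x)"
          using * su(3)[of x] by simp
        moreover note *
        moreover have "0 = (\<phi> y)\<^sup>2 * (G y \<bullet> i)" if "y \<in> - supp \<phi>" for y
          using that su(3)[of y] by simp
        ultimately show ?thesis
          by (rule has_derivative_transform_within_open)
      qed
      then have "((\<lambda>x. (\<phi> x)\<^sup>2 * (G x \<bullet> i)) has_derivative
          (\<lambda>v. 2 * \<phi> x * (gradient \<phi> x \<bullet> v) * (G x \<bullet> i) + (\<phi> x)\<^sup>2 * (G' x v \<bullet> i))) (at (x + 0 *\<^sub>R i))"
        by simp
      moreover have "((\<lambda>t. x + t *\<^sub>R i) has_derivative (\<lambda>t. t *\<^sub>R i)) (at 0)"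
        by (auto intro!: derivative_eq_intros)
      ultimately have *: "((\<lambda>t. (\<phi> (x + t *\<^sub>R i))\<^sup>2 * (G (x + t *\<^sub>R i) \<bullet> i)) has_derivative
          (\<lambda>t. 2 * \<phi> x * (gradient \<phi> x \<bullet> (t *\<^sub>R i)) * (G x \<bullet> i) + (\<phi> x)\<^sup>2 * (G' x (t *\<^sub>R i) \<bullet> i))) (at 0)"
        by (rule has_derivative_compose[rotated])
      \<comment> \<open>\<open>G' x\<close> is known to be linear only for x in \<Omega>; elsewhere
        the factor \<phi> x = 0 removes it.\<close>
      have "(\<phi> x)\<^sup>2 * (G' x (t *\<^sub>R i) \<bullet> i) = (\<phi> x)\<^sup>2 * (t * (G' x i \<bullet> i))" for t
      proof (cases "x \<in> \<Omega>")
        case True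
        then have "linear (G' x)" using G has_derivative_linear by blast
        then show ?thesis by (simp add: linear_scale)
      next
        case False
        then have "x \<notin> supp \<phi>" using su(2) by auto
        then show ?thesis by (simp add: su(3))
      qed
      then have "(\<lambda>t. 2 * \<phi> x * (gradient \<phi> x \<bullet> (t *\<^sub>R i)) * (G x \<bullet> i) + (\<phi> x)\<^sup>2 * (G' x (t *\<^sub>R i) \<bullet> i))
          = (*) (d i x)"
        by (auto simp: d_def algebra_simps)
      then show ?thesis using * unfolding has_field_derivative_def by simp
    qed
  qed (auto simp: su(3) dz dc i)
  have eq: "2 * \<phi> x * (gradient \<phi> x \<bullet> G x) + (\<phi> x)\<^sup>2 * divergence (G' x) = (\<Sum>i\<in>Basis. d i x)" for x
    unfolding d_def divergence_def sum.distrib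
    by (subst euclidean_inner) (simp add: sum_distrib_left mult.assoc)
  show "integrable lborel (\<lambda>x. 2 * \<phi> x * (gradient \<phi> x \<bullet> G x) + (\<phi> x)\<^sup>2 * divergence (G' x))"
    unfolding eq using di by auto
  show "(LINT x|lborel. 2 * \<phi> x * (gradient \<phi> x \<bullet> G x) + (\<phi> x)\<^sup>2 * divergence (G' x)) = 0"
    unfolding eq using di d0 by (subst Bochner_Integration.integral_sum) auto
qed

lemma vector_field_inequality:
  fixes G :: "'a::euclidean_space \<Rightarrow> 'a" and w V :: "'a \<Rightarrow> real"
  assumes \<phi>: "\<phi> \<in> test_functions \<Omega>" and op: "open \<Omega>"
    and G: "\<And>x. x \<in> \<Omega> \<Longrightarrow> (G has_derivative G' x) (at x)"
    and cG: "\<And>i. i \<in> Basis \<Longrightarrow> continuous_on \<Omega> (\<lambda>x. G' x i)"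
    and w: "continuous_on \<Omega> w" "\<And>x. x \<in> \<Omega> \<Longrightarrow> w x > 0"
    and V: "continuous_on \<Omega> V"
    and le: "\<And>x. x \<in> \<Omega> \<Longrightarrow> V x \<le> divergence (G' x) - (norm (G x))\<^sup>2 / w x"
  shows "integrable lborel (\<lambda>x. w x * (norm (gradient \<phi> x))\<^sup>2 - V x * (\<phi> x)\<^sup>2)"
    and "(LINT x|lborel. w x * (norm (gradient \<phi> x))\<^sup>2 - V x * (\<phi> x)\<^sup>2) \<ge> 0"
proof -
  note sm = test_functions_smooth[OF \<phi>]
  note su = test_functions_supp[OF \<phi>]
  have pC: "continuous_on \<Omega> \<phi>" "continuous_on \<Omega> (gradient \<phi>)"
    using smooth_continuous[OF sm] smooth_continuous_gradient[OF sm] continuous_on_subset by blast+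
  have z: "w x * (norm (gradient \<phi> x))\<^sup>2 - V x * (\<phi> x)\<^sup>2 = 0" if "x \<notin> supp \<phi>" for x
    using su gradient_outside_supp[OF sm that] that by simp
  show i1: "integrable lborel (\<lambda>x. w x * (norm (gradient \<phi> x))\<^sup>2 - V x * (\<phi> x)\<^sup>2)"
    by (rule integrable_lborel_continuous_compact[OF continuous_on_mult_test[OF \<phi> op] su(1)])
       (auto intro!: continuous_intros w V pC simp: z)
  have i2: "integrable lborel (\<lambda>x. 2 * \<phi> x * (gradient \<phi> x \<bullet> G x) + (\<phi> x)\<^sup>2 * divergence (G' x))"
    "(LINT x|lborel. 2 * \<phi> x * (gradient \<phi> x \<bullet> G x) + (\<phi> x)\<^sup>2 * divergence (G' x)) = 0"
    using integral_divergence_test[OF \<phi> op, of G G'] G cG by blast+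
  have "0 = (LINT x|lborel. - (2 * \<phi> x * (gradient \<phi> x \<bullet> G x) + (\<phi> x)\<^sup>2 * divergence (G' x)))"
    unfolding Bochner_Integration.integral_minus i2(2) by simp
  also have "\<dots> \<le> (LINT x|lborel. w x * (norm (gradient \<phi> x))\<^sup>2 - V x * (\<phi> x)\<^sup>2
       + 2 * 0)"
  proof -
    \<comment> \<open>Inside \<Omega> the right side minus the left side is w |\<nabla>\<phi> +
      \<phi> G / w|^2 + \<phi>^2 (div G - |G|^2 / w - V), a sum of two nonnegative terms.\<close>
    have "- (2 * \<phi> x * (gradient \<phi> x \<bullet> G x) + (\<phi> x)\<^sup>2 * divergence (G' x))
        \<le> w x * (norm (gradient \<phi> x))\<^sup>2 - V x * (\<phi> x)\<^sup>2" for x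
    proof (cases "x \<in> \<Omega>")
      case False
      then have x: "x \<notin> supp \<phi>" using su(2) by auto
      show ?thesis unfolding z[OF x] unfolding su(3)[OF x] by simp
    next
      case True
      note wx = w(2)[OF True]
      have "0 \<le> w x * (norm (gradient \<phi> x + (\<phi> x / w x) *\<^sub>R G x))\<^sup>2"
        using wx by simp
      also have "\<dots> = w x * (norm (gradient \<phi> x))\<^sup>2 + 2 * \<phi> x * (gradient \<phi> x \<bullet> G x)
          + (\<phi> x)\<^sup>2 * ((norm (G x))\<^sup>2 / w x)"
        unfolding power2_norm_eq_inner using wx
        by (simp add: inner_add_left inner_add_right inner_commute field_simps power2_eq_square)
      finally have "0 \<le> w x * (norm (gradient \<phi> x))\<^sup>2 + 2 * \<phi> x * (gradient \<phi> x \<bullet> G x)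
          + (\<phi> x)\<^sup>2 * ((norm (G x))\<^sup>2 / w x)" .
      moreover have "(\<phi> x)\<^sup>2 * V x \<le> (\<phi> x)\<^sup>2 * (divergence (G' x) - (norm (G x))\<^sup>2 / w x)"
        using le[OF True] by (rule mult_left_mono) simp
      ultimately show ?thesis by (simp add: algebra_simps)
    qed
    then show ?thesis using i1 i2(1)
      by (intro integral_mono) (auto simp del: minus_add_distrib)
  qed
  finally show "(LINT x|lborel. w x * (norm (gradient \<phi> x))\<^sup>2 - V x * (\<phi> x)\<^sup>2) \<ge> 0" by simp
qed

section \<open>Uniqueness of weak gradients\<close>

lemma Ck_SucI:
  assumes "\<And>x. (f has_derivative f' x) (at x)" "\<And>v. Ck k (\<lambda>x. f' x v)"
  shows "Ck (Suc k) f"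
proof -
  have "frechet_derivative f (at x) = f' x" for x
    using frechet_derivative_at[OF assms(1)] by simp
  moreover have "f differentiable_on UNIV"
    using assms(1) by (auto simp: differentiable_on_def differentiable_def)
  ultimately show ?thesis using assms(2) by simp
qed

lemma Ck_SucE:
  assumes "Ck (Suc k) f"
  shows "(f has_derivative frechet_derivative f (at x)) (at x)"
    and "Ck k (\<lambda>x. frechet_derivative f (at x) v)"
  using assms by (auto simp: differentiable_on_def frechet_derivative_works[symmetric])

text \<open>The product rule leaves one factor undifferentiated, so the induction for products needs
  each factor at the lower order as well.\<close>

lemma Ck_Suc_imp_Ck: "Ck (Suc k) f \<Longrightarrow> Ck k f"
proof (induction k arbitrary: f)
  case 0
  then show ?case
    by (auto simp: differentiable_imp_continuous_on)
next
  case (Suc k)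
  then show ?case
    using Ck_SucE[OF Suc.prems] by (intro Ck_SucI) blast+
qed

lemma Ck_const: "Ck k (\<lambda>_. c)"
proof (induction k arbitrary: c)
  case (Suc k)
  show ?case by (rule Ck_SucI[where f'="\<lambda>x v. 0"]) (auto simp: Suc)
qed auto

lemma Ck_add: "Ck k f \<Longrightarrow> Ck k g \<Longrightarrow> Ck k (\<lambda>x. f x + g x)"
proof (induction k arbitrary: f g)
  case (Suc k)
  show ?case
    by (rule Ck_SucI[OF has_derivative_add[OF Ck_SucE(1)[OF Suc.prems(1)] Ck_SucE(1)[OF Suc.prems(2)]]])
       (use Ck_SucE(2)[OF Suc.prems(1)] Ck_SucE(2)[OF Suc.prems(2)] Suc.IH in blast)
qed (auto intro: continuous_intros)

lemma Ck_mult: "Ck k f \<Longrightarrow> Ck k g \<Longrightarrow> Ck k (\<lambda>x. f x * g x)"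
proof (induction k arbitrary: f g)
  case (Suc k)
  show ?case
    by (rule Ck_SucI[OF has_derivative_mult[OF Ck_SucE(1)[OF Suc.prems(1)] Ck_SucE(1)[OF Suc.prems(2)]]])
       (intro Ck_add Suc.IH Ck_SucE(2)[OF Suc.prems(1)] Ck_SucE(2)[OF Suc.prems(2)]
          Ck_Suc_imp_Ck[OF Suc.prems(1)] Ck_Suc_imp_Ck[OF Suc.prems(2)])
qed (auto intro: continuous_intros)

lemma Ck_prod: "(\<And>i. i \<in> I \<Longrightarrow> Ck k (f i)) \<Longrightarrow> Ck k (\<lambda>x. \<Prod>i\<in>I. f i x)"
  by (induction I rule: infinite_finite_induct) (auto intro: Ck_mult Ck_const)

section \<open>Smooth bumps on boxes\<close>

text \<open>The powers of 1/t close the family of exp (-1/t) under differentiation up to linear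
  combinations, so smoothness is an induction on the order with \<open>m\<close> arbitrary.\<close>

definition flat :: "nat \<Rightarrow> real \<Rightarrow> real" where
  "flat m t = (if t > 0 then (1/t) ^ m * exp (- (1/t)) else 0)"

lemma flat_has_real_derivative:
  "(flat m has_real_derivative flat (m + 2) t - m * flat (m + 1) t) (at t)"
proof -
  consider "t > 0" | "t < 0" | "t = 0" by linarith
  then show ?thesis
  proof cases
    case 1
    have inv: "((\<lambda>t. 1/t) has_real_derivative - ((1/t) ^ 2)) (at t)"
      using 1 by (auto intro!: derivative_eq_intros simp: power2_eq_square)
    have "((\<lambda>t. (1/t) ^ m) has_real_derivative - (m * (1/t) ^ (m + 1))) (at t)"
      using DERIV_power[OF inv, of m] by (cases m) (simp_all add: power2_eq_square algebra_simps)
    moreover have "((\<lambda>t. exp (- (1/t))) has_real_derivative exp (- (1/t)) * (1/t) ^ 2) (at t)"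
      using DERIV_chain2[OF DERIV_exp DERIV_minus[OF inv]] by simp
    ultimately have "((\<lambda>t. (1/t) ^ m * exp (- (1/t))) has_real_derivative
        - (m * (1/t) ^ (m + 1)) * exp (- (1/t)) + exp (- (1/t)) * (1/t) ^ 2 * (1/t) ^ m) (at t)"
      by (rule DERIV_mult)
    also have "- (m * (1/t) ^ (m + 1)) * exp (- (1/t)) + exp (- (1/t)) * (1/t) ^ 2 * (1/t) ^ m
        = flat (m + 2) t - m * flat (m + 1) t"
      using 1 by (simp add: flat_def power_add power2_eq_square algebra_simps)
    finally have "((\<lambda>t. (1/t) ^ m * exp (- (1/t))) has_real_derivative flat (m + 2) t - m * flat (m + 1) t) (at t)" .
    then show ?thesis
      by (rule has_field_derivative_transform_within_open[where S="{0<..}"])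
         (use 1 in \<open>auto simp: flat_def\<close>)
  next
    case 2
    have "((\<lambda>t. 0) has_real_derivative flat (m + 2) t - m * flat (m + 1) t) (at t)"
      using 2 by (simp add: flat_def)
    then show ?thesis
      by (rule has_field_derivative_transform_within_open[where S="{..<0}"])
         (use 2 in \<open>auto simp: flat_def\<close>)
  next
    case 3
    \<comment> \<open>With s = 1/h this is the decay of s^(m+1) / exp s at infinity.\<close>
    have "((\<lambda>h. flat m h / h) \<longlongrightarrow> 0) (at_right 0)"
    proof -
      have "((\<lambda>h. inverse h ^ Suc m / exp (inverse h)) \<longlongrightarrow> (0::real)) (at_right 0)"
        by (rule filterlim_compose[OF tendsto_power_div_exp_0 filterlim_inverse_at_top_right])
      moreover have "\<forall>\<^sub>F h in at_right 0. inverse h ^ Suc m / exp (inverse h) = flat m h / h"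
        by (rule eventually_at_right_less[THEN eventually_mono])
           (auto simp: flat_def field_simps exp_minus)
      ultimately show ?thesis
        by (rule Lim_transform_eventually)
    qed
    moreover have "((\<lambda>h. flat m h / h) \<longlongrightarrow> 0) (at_left 0)"
    proof -
      have "\<forall>\<^sub>F h in at_left 0. 0 = flat m h / h"
        by (auto simp: eventually_at_filter flat_def)
      then show ?thesis
        by (rule Lim_transform_eventually[OF tendsto_const])
    qed
    ultimately have "((\<lambda>h. flat m h / h) \<longlongrightarrow> 0) (at 0)"
      by (simp add: filterlim_split_at)
    then show ?thesis using 3 by (simp add: DERIV_def flat_def)
  qed
qed

lemma Ck_flat: "Ck k (\<lambda>x. flat m (b \<bullet> x + a))"
proof (induction k arbitrary: m)
  case 0
  have "continuous_on UNIV (flat m)"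
    using flat_has_real_derivative DERIV_isCont continuous_at_imp_continuous_on by blast
  then have "continuous_on UNIV (flat m \<circ> (\<lambda>x. b \<bullet> x + a))"
    by (intro continuous_on_compose continuous_intros) (auto intro: continuous_on_subset)
  then show ?case by (simp add: o_def)
next
  case (Suc k)
  have "((\<lambda>x. flat m (b \<bullet> x + a)) has_derivative
      (\<lambda>v. (b \<bullet> v) * (flat (m + 2) (b \<bullet> x + a) - m * flat (m + 1) (b \<bullet> x + a)))) (at x)" for x
    by (rule DERIV_compose_FDERIV[OF flat_has_real_derivative]) (auto intro!: derivative_eq_intros)
  then have D: "((\<lambda>x. flat m (b \<bullet> x + a)) has_derivative
      (\<lambda>v. (b \<bullet> v) * (flat (m + 2) (b \<bullet> x + a) + (- m) * flat (m + 1) (b \<bullet> x + a)))) (at x)" for x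
    by simp
  show ?case
    by (rule Ck_SucI[OF D]) (intro Ck_mult Ck_add Ck_const Suc.IH)
qed

text \<open>The factor 1 + n, positive already for n = 0, steepens the edges: all bumps are nonzero
  exactly on the same open box, have values in [0,1], and tend to its indicator. The arguments are
  written as affine maps to match \<open>Ck_flat\<close>.\<close>

definition box_bump :: "'a::euclidean_space \<Rightarrow> 'a \<Rightarrow> nat \<Rightarrow> 'a \<Rightarrow> real" where
  "box_bump a b n x = (\<Prod>i\<in>Basis. flat 0 (((1 + real n) *\<^sub>R i) \<bullet> x + (1 + real n) * - (a \<bullet> i)) *
                                  flat 0 ((- (1 + real n) *\<^sub>R i) \<bullet> x + (1 + real n) * (b \<bullet> i)))"

lemma box_bump_alt:
  "box_bump a b n x = (\<Prod>i\<in>Basis. flat 0 ((1 + real n) * (x \<bullet> i - a \<bullet> i)) *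
                                  flat 0 ((1 + real n) * (b \<bullet> i - x \<bullet> i)))"
  unfolding box_bump_def by (intro prod.cong refl) (simp add: algebra_simps inner_commute)

lemma flat_0_bounds: "0 \<le> flat 0 t" "flat 0 t \<le> 1"
  by (auto simp: flat_def)

lemma box_bump_bounds: "0 \<le> box_bump a b n x" "box_bump a b n x \<le> 1"
  unfolding box_bump_def
  by (auto intro!: prod_nonneg prod_le_1 mult_nonneg_nonneg mult_le_one simp del: inner_minus_left
      simp: flat_0_bounds)

lemma box_bump_nonzero_iff: "box_bump a b n x \<noteq> 0 \<longleftrightarrow> x \<in> box a b"
  by (auto simp: box_bump_alt flat_def mem_box zero_less_mult_iff)

lemma box_bump_test_function:
  assumes "cbox a b \<subseteq> \<Omega>"
  shows "box_bump a b n \<in> test_functions \<Omega>"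
proof -
  have "smooth (box_bump a b n)"
    unfolding smooth_def box_bump_def[abs_def]
    by (intro allI Ck_prod) (rule Ck_mult; rule Ck_flat)
  moreover have "closure (box a b) \<subseteq> cbox a b"
    by (intro closure_minimal box_subset_cbox closed_cbox)
  moreover have "compact (closure (box a b))"
    by (simp add: bounded_box)
  ultimately show ?thesis
    using assms by (auto simp: test_functions_def box_bump_nonzero_iff)
qed

lemma flat_0_tendsto:
  assumes "t > 0" shows "(\<lambda>n. flat 0 ((1 + real n) * t)) \<longlonglongrightarrow> 1"
proof -
  have "(\<lambda>n. exp (- (inverse (real (Suc n)) * (1 / t)))) \<longlonglongrightarrow> exp (- (0 * (1/t)))"
    by (intro tendsto_intros LIMSEQ_inverse_real_of_nat)
  moreover have "exp (- (inverse (real (Suc n)) * (1 / t))) = flat 0 ((1 + real n) * t)" for n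
    using assms mult_pos_pos[of "1 + real n" t] by (simp add: flat_def divide_simps)
  ultimately show ?thesis by simp
qed

lemma box_bump_tendsto: "(\<lambda>n. box_bump a b n x) \<longlonglongrightarrow> indicator (box a b) x"
proof (cases "x \<in> box a b")
  case True
  then have "(\<lambda>n. box_bump a b n x) \<longlonglongrightarrow> (\<Prod>i\<in>(Basis::'a set). 1 * 1)"
    unfolding box_bump_alt
    by (intro tendsto_prod tendsto_mult flat_0_tendsto) (auto simp: mem_box)
  then show ?thesis using True by simp
next
  case False
  then have "box_bump a b n x = 0" for n using box_bump_nonzero_iff by blast
  then show ?thesis using False by simp
qed

section \<open>Fundamental lemma of the calculus of variations\<close>

text \<open>The bumps are admissible test functions and converge boundedly to the indicator of the
  open box; |f| on the closed box is the dominating function, and the faces of the box are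
  negligible.\<close>

lemma orthogonal_test_functions_integral_cbox:
  fixes f :: "'a::euclidean_space \<Rightarrow> real"
  assumes op: "open \<Omega>" and f: "locally_integrable \<Omega> f"
    and z: "\<And>\<phi>. \<phi> \<in> test_functions \<Omega> \<Longrightarrow> (LINT x|lebesgue_on \<Omega>. f x * \<phi> x) = 0"
    and sub: "cbox a b \<subseteq> \<Omega>"
  shows "integral (cbox a b) f = 0"
proof -
  define M where "M = lebesgue_on (cbox a b)"
  have fi: "integrable M f" using f sub by (auto simp: M_def locally_integrable_def)
  have mO: "\<Omega> \<in> sets lebesgue" using op by simp
  have bm: "box_bump a b n \<in> borel_measurable M" for n
  proof -
    have "continuous_on UNIV (box_bump a b n)"
      using box_bump_test_function[OF sub] unfolding test_functions_def smooth_def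
      by (metis (mono_tags, lifting) Ck.simps(1) mem_Collect_eq)
    then show ?thesis
      unfolding M_def by (meson continuous_on_subset continuous_imp_measurable_on_sets_lebesgue lmeasurable_cbox fmeasurableD top_greatest)
  qed
  have e0: "(LINT x|M. f x * box_bump a b n x) = 0" for n
  proof -
    have "(LINT x|lebesgue_on \<Omega>. f x * box_bump a b n x) =
        (LINT x|lebesgue. indicator \<Omega> x *\<^sub>R (f x * box_bump a b n x))"
      using mO by (intro integral_restrict_space) auto
    also have "\<dots> = (LINT x|lebesgue. indicator (cbox a b) x *\<^sub>R (f x * box_bump a b n x))"
    proof (rule Bochner_Integration.integral_cong[OF refl])
      fix x
      show "indicator \<Omega> x *\<^sub>R (f x * box_bump a b n x) = indicator (cbox a b) x *\<^sub>R (f x * box_bump a b n x)"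
        using box_bump_nonzero_iff[of a b n x] box_subset_cbox[of a b] sub
        by (cases "x \<in> box a b") (auto simp: subset_iff)
    qed
    also have "\<dots> = (LINT x|M. f x * box_bump a b n x)"
      unfolding M_def by (intro integral_restrict_space[symmetric]) auto
    finally show ?thesis using z[OF box_bump_test_function[OF sub]] by simp
  qed
  have mi: "indicator (box a b) \<in> borel_measurable M"
    unfolding M_def by (intro measurable_restrict_space1 borel_measurable_indicator) auto
  have "(\<lambda>n. LINT x|M. f x * box_bump a b n x) \<longlonglongrightarrow> (LINT x|M. f x * indicator (box a b) x)"
  proof (rule integral_dominated_convergence)
    show "(\<lambda>x. f x * indicator (box a b) x) \<in> borel_measurable M"
      by (intro borel_measurable_times borel_measurable_integrable fi mi)
    show "(\<lambda>x. f x * box_bump a b n x) \<in> borel_measurable M" for n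
      by (intro borel_measurable_times borel_measurable_integrable fi bm)
    show "integrable M (\<lambda>x. norm (f x))" using fi by simp
    show "AE x in M. (\<lambda>n. f x * box_bump a b n x) \<longlonglongrightarrow> f x * indicator (box a b) x"
      by (auto intro!: tendsto_intros box_bump_tendsto)
    show "AE x in M. norm (f x * box_bump a b n x) \<le> norm (f x)" for n
      using box_bump_bounds[of a b n] by (auto simp: abs_mult mult_left_le)
  qed
  then have "(LINT x|M. f x * indicator (box a b) x) = 0"
    unfolding e0 using LIMSEQ_unique by (metis tendsto_const)
  moreover have "integrable M (\<lambda>x. f x * indicator (box a b) x)"
    by (rule Bochner_Integration.integrable_bound[OF fi])
       (auto intro!: borel_measurable_times borel_measurable_integrable[OF fi] mi AE_I2 split: split_indicator)
  ultimately have "((\<lambda>x. f x * indicator (box a b) x) has_integral 0) (cbox a b)"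
    using has_integral_integral_lebesgue_on[of "cbox a b" "\<lambda>x. f x * indicator (box a b) x"]
    by (simp add: M_def)
  then have "(f has_integral 0) (cbox a b)"
    by (rule has_integral_spike[rotated 2, of _ _ _ "cbox a b - box a b"])
       (auto simp: negligible_frontier_interval)
  then show ?thesis by (rule integral_unique)
qed

text \<open>By Lebesgue differentiation f is almost everywhere the limit of its averages over
  shrinking cubes, and all these averages vanish. Countably many closed boxes cover \<Omega>, and
  passing from open to closed boxes costs a negligible set.\<close>

lemma orthogonal_test_functions_negligible:
  fixes f :: "'a::euclidean_space \<Rightarrow> real"
  assumes op: "open \<Omega>" and f: "locally_integrable \<Omega> f"
    and z: "\<And>\<phi>. \<phi> \<in> test_functions \<Omega> \<Longrightarrow> (LINT x|lebesgue_on \<Omega>. f x * \<phi> x) = 0"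
  shows "negligible {x \<in> \<Omega>. f x \<noteq> 0}"
proof -
  note I0 = orthogonal_test_functions_integral_cbox[OF op f z]
  have loc: "negligible {x \<in> box c d. f x \<noteq> 0}" if sub: "cbox c d \<subseteq> \<Omega>" for c d
  proof -
    \<comment> \<open>Extension by zero gives a function integrable over every box, as the
      differentiation theorem demands.\<close>
    define F where "F = (\<lambda>x. if x \<in> cbox c d then f x else 0)"
    have "integrable (lebesgue_on (cbox c d)) f"
      using f sub by (auto simp: locally_integrable_def)
    then have "f integrable_on cbox c d"
      by (simp add: integrable_on_lebesgue_on)
    then have "F integrable_on UNIV" unfolding F_def by (simp add: integrable_restrict_UNIV)
    then have "F integrable_on cbox a b" for a b
      using integrable_on_subcbox by blast
    from integrable_ccontinuous_explicit[OF this] obtain N where N: "negligible N"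
       "\<And>x e. \<lbrakk>x \<notin> N; 0 < e\<rbrakk> \<Longrightarrow>
               \<exists>d>0. \<forall>h. 0 < h \<and> h < d \<longrightarrow>
                         norm(integral (cbox x (x + h *\<^sub>R One)) F /\<^sub>R h ^ DIM('a) - F x) < e"
      by blast
    have "f x = 0" if x: "x \<in> box c d" "x \<notin> N" for x
    proof (rule ccontr)
      assume "f x \<noteq> 0"
      then obtain \<delta> where \<delta>: "\<delta> > 0" "\<And>h. 0 < h \<and> h < \<delta> \<Longrightarrow>
          norm(integral (cbox x (x + h *\<^sub>R One)) F /\<^sub>R h ^ DIM('a) - F x) < \<bar>f x\<bar>"
        using N(2)[OF x(2), of "\<bar>f x\<bar>"] by auto
      obtain e where e: "e > 0" "ball x e \<subseteq> box c d"
        using open_box x(1) open_contains_ball by blast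
      \<comment> \<open>The sum of the coordinates bounds the norm, so a side of at most e / (2 DIM)
        keeps the cube with corner \<open>x\<close> inside \<open>ball x e\<close>; the half in
        front of \<delta> makes the bound on the side strict.\<close>
      define h where "h = min (\<delta> / 2) (e / (2 * real DIM('a)))"
      have h: "h > 0" "h < \<delta>" using \<delta>(1) e(1) by (auto simp: h_def)
      have sb: "cbox x (x + h *\<^sub>R One) \<subseteq> cbox c d"
      proof
        fix y assume y: "y \<in> cbox x (x + h *\<^sub>R One)"
        have "norm (y - x) \<le> (\<Sum>i\<in>Basis. \<bar>(y - x) \<bullet> i\<bar>)" by (rule norm_le_l1)
        also have "\<dots> \<le> (\<Sum>i\<in>(Basis::'a set). h)"
          using y by (intro sum_mono) (auto simp: mem_box algebra_simps)
        also have "\<dots> = DIM('a) * h" by simp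
        also have "\<dots> \<le> DIM('a) * (e / (2 * real DIM('a)))"
          by (intro mult_left_mono) (auto simp: h_def)
        also have "\<dots> < e" using e(1) by simp
        finally have "y \<in> ball x e" by (simp add: dist_norm norm_minus_commute)
        then show "y \<in> cbox c d" using e(2) box_subset_cbox by blast
      qed
      have "integral (cbox x (x + h *\<^sub>R One)) F = integral (cbox x (x + h *\<^sub>R One)) f"
        using sb by (intro Henstock_Kurzweil_Integration.integral_cong) (auto simp: F_def)
      also have "\<dots> = 0" using I0 sb sub by blast
      finally have "norm (F x) < \<bar>f x\<bar>" using \<delta>(2)[of h] h by simp
      moreover have "F x = f x" using x box_subset_cbox by (auto simp: F_def)
      ultimately show False by simp
    qed
    then have "{x \<in> box c d. f x \<noteq> 0} \<subseteq> N" by auto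
    then show ?thesis using N(1) negligible_subset by blast
  qed
  obtain D where D: "countable D" "D \<subseteq> Pow \<Omega>" "\<And>X. X \<in> D \<Longrightarrow> \<exists>a b. X = cbox a b" "\<Union>D = \<Omega>"
    using open_countable_Union_open_cbox[OF op] by blast
  have "negligible {x \<in> X. f x \<noteq> 0}" if "X \<in> D" for X
  proof -
    obtain a b where X: "X = cbox a b" using D(3) \<open>X \<in> D\<close> by blast
    have "negligible ({x \<in> box a b. f x \<noteq> 0} \<union> (cbox a b - box a b))"
      using loc[of a b] D(2) \<open>X \<in> D\<close> X by (intro negligible_Un negligible_frontier_interval) auto
    then show ?thesis by (rule negligible_subset) (auto simp: X)
  qed
  then have "negligible (\<Union>X\<in>D. {x \<in> X. f x \<noteq> 0})"
    using D(1) by (intro negligible_countable_Union) auto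
  moreover have "(\<Union>X\<in>D. {x \<in> X. f x \<noteq> 0}) = {x \<in> \<Omega>. f x \<noteq> 0}"
    using D(4) by auto
  ultimately show ?thesis by simp
qed

text \<open>Each coordinate of the difference is orthogonal to all test functions. This reconciles
  the weak gradient chosen inside \<open>H10\<close> with the arbitrary one quantified in the
  theorem.\<close>

lemma weak_gradient_unique:
  fixes \<Omega> :: "'a::euclidean_space set"
  assumes op: "open \<Omega>" and g: "has_weak_gradient \<Omega> u g" and h: "has_weak_gradient \<Omega> u h"
  shows "negligible {x \<in> \<Omega>. g x \<noteq> h x}"
proof -
  have test_meas: "\<phi> \<in> borel_measurable (lebesgue_on S)" if "\<phi> \<in> test_functions \<Omega>" "S \<in> sets lebesgue" for \<phi> S
  proof -
    have "Ck 0 \<phi>"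
      using that unfolding test_functions_def smooth_def by blast
    then have "continuous_on S \<phi>"
      using continuous_on_subset by auto
    then show ?thesis
      using that(2) by (rule continuous_imp_measurable_on_sets_lebesgue)
  qed
  \<comment> \<open>The integral of a difference splits only for integrable terms. Local
    integrability suffices, as \<phi> is bounded with compact support in \<Omega>.\<close>
  have int: "integrable (lebesgue_on \<Omega>) (\<lambda>x. (f x \<bullet> i) * \<phi> x)"
    if f: "locally_integrable \<Omega> f" and \<phi>: "\<phi> \<in> test_functions \<Omega>" for f \<phi> and i :: 'a
  proof -
    define K where "K = closure {x. \<phi> x \<noteq> 0}"
    have K: "compact K" "K \<subseteq> \<Omega>" "\<And>x. x \<notin> K \<Longrightarrow> \<phi> x = 0"
      using \<phi> closure_subset[of "{x. \<phi> x \<noteq> 0}"] by (auto simp: test_functions_def K_def)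
    have mK: "K \<in> sets lebesgue" using K(1) by (simp add: borel_compact)
    have "Ck 0 \<phi>"
      using \<phi> unfolding test_functions_def smooth_def by blast
    then have "continuous_on K \<phi>"
      using continuous_on_subset by auto
    then have "bounded (\<phi> ` K)"
      by (intro compact_imp_bounded compact_continuous_image K(1))
    then obtain B where B: "\<And>x. x \<in> K \<Longrightarrow> \<bar>\<phi> x\<bar> \<le> B"
      by (auto simp: bounded_iff)
    have "integrable (lebesgue_on K) f" using f K by (auto simp: locally_integrable_def)
    then have fi: "integrable (lebesgue_on K) (\<lambda>x. f x \<bullet> i)" by simp
    have "integrable (lebesgue_on K) (\<lambda>x. (f x \<bullet> i) * \<phi> x)"
    proof (rule Bochner_Integration.integrable_bound)
      show "integrable (lebesgue_on K) (\<lambda>x. B * (f x \<bullet> i))" using fi by simp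
      show "(\<lambda>x. (f x \<bullet> i) * \<phi> x) \<in> borel_measurable (lebesgue_on K)"
        by (intro borel_measurable_times borel_measurable_integrable fi test_meas[OF \<phi> mK])
      have "norm ((f x \<bullet> i) * \<phi> x) \<le> norm (B * (f x \<bullet> i))" if "x \<in> K" for x
      proof -
        have "\<bar>f x \<bullet> i\<bar> * \<bar>\<phi> x\<bar> \<le> \<bar>f x \<bullet> i\<bar> * \<bar>B\<bar>"
          using B[OF that] by (intro mult_left_mono) auto
        then show ?thesis by (simp add: abs_mult mult.commute)
      qed
      then show "AE x in lebesgue_on K. norm ((f x \<bullet> i) * \<phi> x) \<le> norm (B * (f x \<bullet> i))"
        by (intro AE_I2) (auto simp: space_restrict_space)
    qed
    then have "integrable lebesgue (\<lambda>x. indicator K x *\<^sub>R ((f x \<bullet> i) * \<phi> x))"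
      using mK by (subst (asm) integrable_restrict_space) auto
    also have "(\<lambda>x. indicator K x *\<^sub>R ((f x \<bullet> i) * \<phi> x)) = (\<lambda>x. indicator \<Omega> x *\<^sub>R ((f x \<bullet> i) * \<phi> x))"
      using K(2,3) by (auto simp: fun_eq_iff indicator_def)
    finally show ?thesis
      using op by (subst integrable_restrict_space) auto
  qed
  have lg: "locally_integrable \<Omega> g" and lh: "locally_integrable \<Omega> h"
    using g h by (auto simp: has_weak_gradient_def)
  have "negligible {x \<in> \<Omega>. (g x - h x) \<bullet> i \<noteq> 0}" if i: "i \<in> Basis" for i
  proof (rule orthogonal_test_functions_negligible[OF op])
    show "locally_integrable \<Omega> (\<lambda>x. (g x - h x) \<bullet> i)"
      using lg lh by (auto simp: locally_integrable_def)
    show "(LINT x|lebesgue_on \<Omega>. ((g x - h x) \<bullet> i) * \<phi> x) = 0" if \<phi>: "\<phi> \<in> test_functions \<Omega>" for \<phi>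
    proof -
      have "- (LINT x|lebesgue_on \<Omega>. (g x \<bullet> i) * \<phi> x) = - (LINT x|lebesgue_on \<Omega>. (h x \<bullet> i) * \<phi> x)"
      proof -
        have "(LINT x|lebesgue_on \<Omega>. u x * frechet_derivative \<phi> (at x) i) =
            - (LINT x|lebesgue_on \<Omega>. (g x \<bullet> i) * \<phi> x)"
          using g i \<phi> unfolding has_weak_gradient_def by blast
        moreover have "(LINT x|lebesgue_on \<Omega>. u x * frechet_derivative \<phi> (at x) i) =
            - (LINT x|lebesgue_on \<Omega>. (h x \<bullet> i) * \<phi> x)"
          using h i \<phi> unfolding has_weak_gradient_def by blast
        ultimately show ?thesis by simp
      qed
      then have "(LINT x|lebesgue_on \<Omega>. (g x \<bullet> i) * \<phi> x) - (LINT x|lebesgue_on \<Omega>. (h x \<bullet> i) * \<phi> x) = 0"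
        by linarith
      then show ?thesis
        by (simp add: inner_diff_left left_diff_distrib
            Bochner_Integration.integral_diff[OF int[OF lg \<phi>] int[OF lh \<phi>]])
    qed
  qed
  then have "negligible (\<Union>i\<in>Basis. {x \<in> \<Omega>. (g x - h x) \<bullet> i \<noteq> 0})"
    by (intro negligible_Union) auto
  moreover have "{x \<in> \<Omega>. g x \<noteq> h x} \<subseteq> (\<Union>i\<in>Basis. {x \<in> \<Omega>. (g x - h x) \<bullet> i \<noteq> 0})"
  proof
    fix x assume x: "x \<in> {x \<in> \<Omega>. g x \<noteq> h x}"
    then have "g x - h x \<noteq> 0" by simp
    then obtain i where "i \<in> Basis" "(g x - h x) \<bullet> i \<noteq> 0"
      using euclidean_all_zero_iff by blast
    then show "x \<in> (\<Union>i\<in>Basis. {x \<in> \<Omega>. (g x - h x) \<bullet> i \<noteq> 0})"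
      using x by blast
  qed
  ultimately show ?thesis by (rule negligible_subset)
qed

section \<open>Boundary defining functions\<close>

lemma Ck_compose_linear:
  fixes f :: "'a::euclidean_space \<Rightarrow> real" and T :: "'a \<Rightarrow> 'a"
  assumes "bounded_linear T"
  shows "Ck k f \<Longrightarrow> Ck k (\<lambda>x. f (T x))"
proof (induction k arbitrary: f)
  case 0
  then show ?case
    using continuous_on_compose[of UNIV T f] linear_continuous_on[OF assms]
    by (auto simp: o_def intro: continuous_on_subset)
next
  case (Suc k)
  have T: "(T has_derivative T) (at x)" for x
    using assms by (rule bounded_linear_imp_has_derivative)
  show ?case
    by (rule Ck_SucI[OF has_derivative_compose[OF T Ck_SucE(1)[OF Suc.prems]]])
       (rule Suc.IH[OF Ck_SucE(2)[OF Suc.prems]])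
qed

lemma smooth_inner: "smooth (\<lambda>x. x \<bullet> e)"
  unfolding smooth_def
proof
  fix k show "Ck k (\<lambda>x. x \<bullet> e)"
  proof (cases k)
    case 0
    then show ?thesis by (auto intro: continuous_intros)
  next
    case (Suc n)
    have "((\<lambda>x. x \<bullet> e) has_derivative (\<lambda>v. v \<bullet> e)) (at x)" for x :: 'a
      by (auto intro!: derivative_eq_intros)
    then show ?thesis unfolding Suc by (rule Ck_SucI) (rule Ck_const)
  qed
qed

lemma smooth_diff: "smooth f \<Longrightarrow> smooth g \<Longrightarrow> smooth (\<lambda>x. f x - g x)"
  unfolding smooth_def using Ck_add[OF _ Ck_mult[OF Ck_const[of _ "-1"]], of _ f g] by simp

lemma smooth_frechet_derivative: "smooth f \<Longrightarrow> smooth (\<lambda>x. frechet_derivative f (at x) v)"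
  unfolding smooth_def using Ck_SucE(2) by blast

section \<open>Taylor bounds at the origin and the height function\<close>

text \<open>For smooth f this is the derivative of the gradient field as a linear map in
  \<open>v\<close>; its \<open>divergence\<close> is the Laplacian of f.\<close>

definition hessian :: "('a::euclidean_space \<Rightarrow> real) \<Rightarrow> 'a \<Rightarrow> 'a \<Rightarrow> 'a" where
  "hessian f x v = (\<Sum>i\<in>Basis. (gradient (\<lambda>y. frechet_derivative f (at y) i) x \<bullet> v) *\<^sub>R i)"

lemma smooth_gradient_has_derivative:
  assumes "smooth f"
  shows "(gradient f has_derivative hessian f x) (at x)"
  unfolding gradient_def[abs_def]
  unfolding hessian_def[abs_def]
  by (intro has_derivative_sum has_derivative_scaleR_left smooth_has_gradient
      smooth_frechet_derivative assms)

lemma smooth_continuous_hessian: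
  assumes "smooth f"
  shows "continuous_on UNIV (\<lambda>x. hessian f x v)"
  unfolding hessian_def
  by (intro continuous_intros smooth_continuous_gradient smooth_frechet_derivative assms)

lemma continuous_bounded_cball:
  fixes f :: "'a::euclidean_space \<Rightarrow> 'b::euclidean_space"
  assumes "continuous_on UNIV f"
  obtains B where "B \<ge> 0" "\<And>x. norm x \<le> 1 \<Longrightarrow> norm (f x) \<le> B"
proof -
  have "bounded (f ` cball 0 1)"
    by (intro compact_imp_bounded compact_continuous_image continuous_on_subset[OF assms]) auto
  then obtain B where "B > 0" "\<forall>x\<in>cball 0 1. norm (f x) \<le> B"
    by (auto simp: bounded_pos)
  then show ?thesis using that[of B] by simp
qed

text \<open>The mean value theorem along the segment from 0 gives f x = \<nabla>f(z x) \<bullet> x,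
  and the gradient is Lipschitz on the unit ball. The bound on \<nabla>f x \<bullet> x - f x
  measures the distance from the flat case, where f is linear and the expression vanishes.\<close>

lemma smooth_local_bounds:
  fixes f :: "'a::euclidean_space \<Rightarrow> real"
  assumes sm: "smooth f" and f0: "f 0 = 0"
  obtains M where "M \<ge> 1"
    "\<And>x. norm x \<le> 1 \<Longrightarrow> norm (gradient f x) \<le> M"
    "\<And>x. norm x \<le> 1 \<Longrightarrow> \<bar>divergence (hessian f x)\<bar> \<le> M"
    "\<And>x. norm x \<le> 1 \<Longrightarrow> \<bar>gradient f x \<bullet> x - f x\<bar> \<le> M * (norm x)\<^sup>2"
    "\<And>x. norm x \<le> 1 \<Longrightarrow> \<bar>f x\<bar> \<le> M * norm x"
proof -
  obtain M1 where M1: "M1 \<ge> 0" "\<And>x. norm x \<le> 1 \<Longrightarrow> norm (gradient f x) \<le> M1"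
    using continuous_bounded_cball[OF smooth_continuous_gradient[OF sm]] by blast
  have "continuous_on UNIV (\<lambda>x. divergence (hessian f x))"
    unfolding divergence_def by (intro continuous_intros smooth_continuous_hessian sm)
  then obtain M2 where M2: "M2 \<ge> 0" "\<And>x. norm x \<le> 1 \<Longrightarrow> \<bar>divergence (hessian f x)\<bar> \<le> M2"
    using continuous_bounded_cball[of "\<lambda>x. divergence (hessian f x)"] by (metis real_norm_def)
  \<comment> \<open>The sum of the row norms bounds the operator norm of the Hessian and is visibly
    continuous.\<close>
  define H where "H = (\<lambda>x. \<Sum>i\<in>(Basis::'a set). norm (gradient (\<lambda>y. frechet_derivative f (at y) i) x))"
  have "continuous_on UNIV H"
    unfolding H_def
    by (intro continuous_intros smooth_continuous_gradient smooth_frechet_derivative sm)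
  then obtain M3 where M3: "M3 \<ge> 0" "\<And>x. norm x \<le> 1 \<Longrightarrow> \<bar>H x\<bar> \<le> M3"
    using continuous_bounded_cball[of H] by (metis real_norm_def)
  have on: "onorm (hessian f x) \<le> M3" if "x \<in> cball 0 1" for x
  proof (rule onorm_le)
    fix v
    have "norm (hessian f x v) \<le> (\<Sum>i\<in>(Basis::'a set). norm ((gradient (\<lambda>y. frechet_derivative f (at y) i) x \<bullet> v) *\<^sub>R i))"
      unfolding hessian_def by (rule norm_sum)
    also have "\<dots> \<le> (\<Sum>i\<in>(Basis::'a set). norm (gradient (\<lambda>y. frechet_derivative f (at y) i) x) * norm v)"
      by (intro sum_mono) (auto intro: Cauchy_Schwarz_ineq2)
    also have "\<dots> = H x * norm v" by (simp add: H_def sum_distrib_right)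
    also have "\<dots> \<le> M3 * norm v"
      using M3(2)[of x] that by (intro mult_right_mono) auto
    finally show "norm (hessian f x v) \<le> M3 * norm v" .
  qed
  have lip: "norm (gradient f x - gradient f y) \<le> M3 * norm (x - y)"
    if "norm x \<le> 1" "norm y \<le> 1" for x y
    by (rule differentiable_bound[of "cball 0 1" "gradient f" "hessian f"])
       (use that on in \<open>auto intro: has_derivative_at_withinI[OF smooth_gradient_has_derivative[OF sm]]\<close>)
  have mvt: "\<exists>z. 0 < z \<and> z < 1 \<and> f x = gradient f (z *\<^sub>R x) \<bullet> x" for x
  proof -
    have "((\<lambda>t. f (t *\<^sub>R x)) has_real_derivative gradient f (t *\<^sub>R x) \<bullet> x) (at t)" for t
    proof -
      have "((\<lambda>t. t *\<^sub>R x) has_derivative (\<lambda>s. s *\<^sub>R x)) (at t)"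
        by (auto intro!: derivative_eq_intros)
      from has_derivative_compose[OF this smooth_has_gradient[OF sm]]
      have "((\<lambda>t. f (t *\<^sub>R x)) has_derivative (\<lambda>s. s * (gradient f (t *\<^sub>R x) \<bullet> x))) (at t)"
        by simp
      then show ?thesis
        by (simp add: has_field_derivative_def mult_commute_abs)
    qed
    from MVT2[of 0 1 "\<lambda>t. f (t *\<^sub>R x)" "\<lambda>t. gradient f (t *\<^sub>R x) \<bullet> x", OF _ this]
    show ?thesis using f0 by auto
  qed
  define M where "M = 1 + M1 + M2 + M3"
  show ?thesis
  proof (rule that[of M])
    show "M \<ge> 1" using M1 M2 M3 by (simp add: M_def)
    fix x :: 'a assume x: "norm x \<le> 1"
    show "norm (gradient f x) \<le> M" using M1(2)[OF x] M1(1) M2(1) M3(1) by (simp add: M_def)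
    show "\<bar>divergence (hessian f x)\<bar> \<le> M" using M2(2)[OF x] M1(1) M2(1) M3(1) by (simp add: M_def)
    obtain z where z: "0 < z" "z < 1" "f x = gradient f (z *\<^sub>R x) \<bullet> x" using mvt by blast
    have zx: "norm (z *\<^sub>R x) \<le> 1" using z x by (simp add: mult_le_one)
    have "\<bar>f x\<bar> \<le> norm (gradient f (z *\<^sub>R x)) * norm x"
      unfolding z(3) by (rule Cauchy_Schwarz_ineq2)
    also have "\<dots> \<le> M * norm x"
      using M1(2)[OF zx] M2(1) M3(1) by (intro mult_right_mono) (auto simp: M_def)
    finally show "\<bar>f x\<bar> \<le> M * norm x" .
    have "\<bar>gradient f x \<bullet> x - f x\<bar> = \<bar>(gradient f x - gradient f (z *\<^sub>R x)) \<bullet> x\<bar>"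
      by (simp add: z(3) inner_diff_left)
    also have "\<dots> \<le> norm (gradient f x - gradient f (z *\<^sub>R x)) * norm x"
      by (rule Cauchy_Schwarz_ineq2)
    also have "\<dots> \<le> (M3 * norm (x - z *\<^sub>R x)) * norm x"
      using lip[OF x zx] by (intro mult_right_mono) auto
    also have "norm (x - z *\<^sub>R x) = (1 - z) * norm x"
      using z(2) norm_scaleR[of "1 - z" x] by (simp add: scaleR_diff_left)
    also have "M3 * ((1 - z) * norm x) * norm x = (M3 * (1 - z)) * (norm x)\<^sup>2"
      by (simp add: power2_eq_square)
    also have "\<dots> \<le> M * (norm x)\<^sup>2"
    proof (intro mult_right_mono)
      have "M3 * (1 - z) \<le> M3 * 1" using z M3(1) by (intro mult_left_mono) auto
      then show "M3 * (1 - z) \<le> M" using M1(1) M2(1) by (simp add: M_def)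
    qed auto
    finally show "\<bar>gradient f x \<bullet> x - f x\<bar> \<le> M * (norm x)\<^sup>2" .
  qed
qed

text \<open>The height above the local graph serves as \<delta>. It is smooth on the whole space,
  and the projection \<open>T\<close> annihilates \<open>e\<close>, so its derivative in direction
  \<open>e\<close> is 1 everywhere; this bounds the gradient from below.\<close>

lemma boundary_defining_function:
  fixes \<Omega> :: "'a::euclidean_space set"
  assumes op: "open \<Omega>" and sb: "smooth_boundary \<Omega>" and fr: "0 \<in> frontier \<Omega>"
  obtains f r where "smooth f" "f 0 = 0" "r > 0"
    "\<And>x. x \<in> \<Omega> \<Longrightarrow> norm x < r \<Longrightarrow> f x > 0" "\<And>x. norm (gradient f x) \<ge> 1"
proof -
  obtain r e h where r: "r > 0" "norm e = 1" "smooth h"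
    and eq: "\<Omega> \<inter> ball 0 r = {x \<in> ball 0 r. h (x - (x \<bullet> e) *\<^sub>R e) < x \<bullet> e}"
    using sb fr unfolding smooth_boundary_def by blast
  define T where "T = (\<lambda>x. x - (x \<bullet> e) *\<^sub>R e)"
  have bT: "bounded_linear T"
    unfolding T_def by (intro bounded_linear_intros)
  have Te: "T e = 0" using r(2) by (simp add: T_def norm_eq_1)
  define f where "f = (\<lambda>x. x \<bullet> e - h (T x))"
  have smhT: "smooth (\<lambda>x. h (T x))"
    using r(3) Ck_compose_linear[OF bT] by (auto simp: smooth_def)
  have sm: "smooth f"
    unfolding f_def by (intro smooth_diff smooth_inner smhT)
  have pos: "x \<in> \<Omega> \<longleftrightarrow> f x > 0" if "norm x < r" for x
  proof -
    have "x \<in> ball 0 r" using that by simp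
    then show ?thesis using eq by (auto simp: f_def T_def set_eq_iff)
  qed
  \<comment> \<open>A positive value would put 0 into the open set \<Omega>; a negative one would
    persist nearby and exclude points of \<Omega> from a neighbourhood of 0.\<close>
  have f0: "f 0 = 0"
  proof -
    have n0: "0 \<notin> \<Omega>" using fr op by (simp add: frontier_def interior_open)
    then have "f 0 \<le> 0" using pos[of 0] r(1) by simp
    moreover have "f 0 \<ge> 0"
    proof (rule ccontr)
      assume "\<not> f 0 \<ge> 0"
      moreover have "continuous_on UNIV f" using smooth_continuous[OF sm] .
      ultimately have "open (f -` {..<0})" "0 \<in> f -` {..<0}"
        by (auto intro: open_vimage)
      then obtain d where d: "d > 0" "ball 0 d \<subseteq> f -` {..<0}"
        using open_contains_ball by blast
      have "0 \<in> closure \<Omega>" using fr by (simp add: frontier_def)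
      then obtain y where y: "y \<in> \<Omega>" "dist y 0 < min d r"
        using closure_approachable[of 0 \<Omega>] d r(1) by (metis min_less_iff_conj)
      then have "f y > 0" using pos by simp
      moreover have "y \<in> ball 0 d" using y by simp
      ultimately show False using d(2) by force
    qed
    ultimately show ?thesis by simp
  qed
  have "norm (gradient f x) \<ge> 1" for x
  proof -
    have "((\<lambda>y. y \<bullet> e) has_derivative (\<lambda>v. v \<bullet> e)) (at x)"
      by (auto intro!: derivative_eq_intros)
    moreover have "((\<lambda>y. h (T y)) has_derivative (\<lambda>v. gradient h (T x) \<bullet> T v)) (at x)"
      by (rule has_derivative_compose[OF bounded_linear_imp_has_derivative[OF bT] smooth_has_gradient[OF r(3)]])
    ultimately have "(f has_derivative (\<lambda>v. v \<bullet> e - gradient h (T x) \<bullet> T v)) (at x)"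
      unfolding f_def by (rule has_derivative_diff)
    then have "(\<lambda>v. gradient f x \<bullet> v) = (\<lambda>v. v \<bullet> e - gradient h (T x) \<bullet> T v)"
      using smooth_has_gradient[OF sm] has_derivative_unique by blast
    then have "gradient f x \<bullet> e = 1"
      using Te r(2) by (simp add: fun_eq_iff norm_eq_1)
    then show ?thesis
      using Cauchy_Schwarz_ineq2[of "gradient f x" e] r(2) by simp
  qed
  then show ?thesis using that[OF sm f0 r(1)] pos by blast
qed

section \<open>The field near the origin\<close>

text \<open>With \<open>D = \<nabla>\<delta>\<close> the numbers below are \<open>dd = |D|\<^sup>2\<close>, \<open>L = \<Delta>\<delta>\<close>, \<open>s = D \<bullet> x\<close>, \<open>a = 1/\<delta>\<close>,
  \<open>y = 1/|x|\<^sup>2\<close>, and \<open>P = A D + (b/|x|\<^sup>2) x\<close> is \<open>\<nabla>\<psi> / \<psi>\<close>. The lower bound is for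
  \<open>- div P - |P|\<^sup>2 = - \<Delta>\<psi> / \<psi>\<close>.\<close>

lemma riccati_estimate:
  fixes N \<epsilon> K M B \<rho> r d dd L s a y A b :: real
  assumes M: "M \<ge> 1" and N: "N \<ge> 0" and \<epsilon>: "0 < \<epsilon>" and \<rho>: "0 < \<rho>" "\<rho> \<le> \<epsilon> / 4" "\<rho> \<le> 1"
    and r: "r > 0" and d: "d > 0" and B: "B = N / 2 + 1" and K: "K = 3 * M + 2 * B * M"
    and a: "a = 1 / d" and y: "y = 1 / r\<^sup>2" and A: "A = a - K" and b: "b = - N / 2 - \<rho>"
    and dM: "d \<le> M * r" and Kd: "K * d \<le> 1" and small: "8 * B * K * M * r \<le> \<epsilon> * \<rho>"
    and dd: "dd \<ge> 1" and L: "\<bar>L\<bar> \<le> M" and s: "\<bar>s - d\<bar> \<le> M * r\<^sup>2"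
  shows "(N\<^sup>2 / 4 + \<epsilon> * \<rho> / 2) * y + 2 * M * a \<le>
    - (- dd * a\<^sup>2 + A * L + (N + (2 - \<epsilon>) * \<rho>) * y + N * b * y)
    - (A\<^sup>2 * dd + 2 * A * b * y * s + b\<^sup>2 * y)"
proof -
  define \<tau> where "\<tau> = s - d"
  have ad: "a * d = 1" and a0: "a > 0" and y0: "y > 0" and yr: "y * r\<^sup>2 = 1"
    using a d y r by auto
  have B0: "B \<ge> 1" using B N by simp
  have K0: "K > 0" using K M B0 by (simp add: add_pos_nonneg)
  have Ka: "K \<le> a" using Kd d by (simp add: a field_simps)
  have A0: "0 \<le> A" "A \<le> a" using Ka K0 A by auto
  have bB: "\<bar>b\<bar> \<le> B" using b B N \<rho> by (auto simp: abs_le_iff)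
  have Ad: "A * d = 1 - K * d" using ad by (simp add: A left_diff_distrib)
  have "A * b * y * s = b * y * (A * d) + A * b * y * \<tau>"
    by (simp add: \<tau>_def algebra_simps)
  then have As: "A * b * y * s = b * y - b * y * (K * d) + A * b * y * \<tau>"
    unfolding Ad by (simp add: algebra_simps)
  \<comment> \<open>Completing the square, b^2 + N b = (b + N/2)^2 - N^2/4: here the Hardy constant
    appears.\<close>
  have bb: "b\<^sup>2 + N * b = \<rho>\<^sup>2 - N\<^sup>2 / 4"
    by (simp add: b power2_eq_square algebra_simps)
  have A2: "a\<^sup>2 - A\<^sup>2 = 2 * K * a - K\<^sup>2" by (simp add: A power2_eq_square algebra_simps)
  have "- (- dd * a\<^sup>2 + A * L + (N + (2 - \<epsilon>) * \<rho>) * y + N * b * y)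
      - (A\<^sup>2 * dd + 2 * A * b * y * s + b\<^sup>2 * y)
    = dd * (a\<^sup>2 - A\<^sup>2) - A * L - (b\<^sup>2 + N * b) * y - (N + (2 - \<epsilon>) * \<rho>) * y - 2 * (A * b * y * s)"
    by (simp add: algebra_simps)
  also have "\<dots> = dd * (2 * K * a - K\<^sup>2) - A * L + (N\<^sup>2 / 4 + \<epsilon> * \<rho> - \<rho>\<^sup>2) * y
      + 2 * b * y * (K * d) - 2 * (A * b * y * \<tau>) - (N + 2 * \<rho> + 2 * b) * y"
    unfolding bb A2 As by (simp add: algebra_simps)
  \<comment> \<open>The value of \<open>b\<close> cancels the cross term b y of the flat model
    against the derivative of the radial coefficient; only the gain \<epsilon> \<rho> y
    survives.\<close>
  also have "N + 2 * \<rho> + 2 * b = 0" by (simp add: b)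
  finally have eq: "- (- dd * a\<^sup>2 + A * L + (N + (2 - \<epsilon>) * \<rho>) * y + N * b * y)
      - (A\<^sup>2 * dd + 2 * A * b * y * s + b\<^sup>2 * y)
    = dd * (2 * K * a - K\<^sup>2) - A * L + (N\<^sup>2 / 4 + \<epsilon> * \<rho> - \<rho>\<^sup>2) * y
      + 2 * b * y * (K * d) - 2 * (A * b * y * \<tau>)" by simp
  \<comment> \<open>This is the gain from exp (-K \<delta>): lowering \<open>a\<close> to
    \<open>A\<close> saves 2 K a - K^2, and K d \<le> 1 means K \<le> a.\<close>
  have 1: "dd * (2 * K * a - K\<^sup>2) \<ge> K * a"
  proof -
    have "K * K \<le> K * a" using Ka K0 by simp
    then have "2 * K * a - K\<^sup>2 \<ge> K * a" by (simp add: power2_eq_square)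
    moreover have "K * a \<ge> 0" using K0 a0 by simp
    ultimately show ?thesis
      using dd mult_mono[of 1 dd "K * a" "2 * K * a - K\<^sup>2"] by simp
  qed
  have 2: "A * L \<le> a * M"
  proof -
    have "A * L \<le> A * M" using L A0 by (intro mult_left_mono) auto
    also have "\<dots> \<le> a * M" using A0 M by (intro mult_right_mono) auto
    finally show ?thesis .
  qed
  have y\<tau>: "y * \<bar>\<tau>\<bar> \<le> M"
  proof -
    have "y * \<bar>\<tau>\<bar> \<le> y * (M * r\<^sup>2)" using s y0 by (intro mult_left_mono) (auto simp: \<tau>_def)
    then show ?thesis using yr by (simp add: algebra_simps)
  qed
  have 3: "A * b * y * \<tau> \<le> a * (B * M)"
  proof -
    have "A * b * y * \<tau> \<le> \<bar>A * b * y * \<tau>\<bar>" by simp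
    also have "\<dots> = A * (\<bar>b\<bar> * (y * \<bar>\<tau>\<bar>))" using A0 y0 by (simp add: abs_mult)
    also have "\<dots> \<le> a * (B * M)"
      using A0 bB y\<tau> B0 y0 M by (intro mult_mono) auto
    finally show ?thesis .
  qed
  \<comment> \<open>The price of \<open>K\<close>: the radial part meets K \<nabla>\<delta> in a
    term of order 1/r. Only for small r is it below a fraction of \<epsilon> \<rho> / r^2, which is
    the hypothesis \<open>small\<close>.\<close>
  have 4: "- (b * y * (K * d)) \<le> (\<epsilon> * \<rho> / 8) * y"
  proof -
    have "- (b * y * (K * d)) \<le> \<bar>b\<bar> * (y * (K * d))"
      using y0 K0 d abs_le_D2[of b "\<bar>b\<bar>"] mult_right_mono[of "- b" "\<bar>b\<bar>" "y * (K * d)"]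
      by (simp add: mult.assoc)
    also have "\<dots> \<le> B * (y * (K * (M * r)))"
      using bB y0 K0 d dM B0 by (intro mult_mono mult_nonneg_nonneg) auto
    also have "\<dots> = (B * K * M * r) * y" by (simp add: algebra_simps)
    also have "\<dots> \<le> (\<epsilon> * \<rho> / 8) * y" using small y0 by (intro mult_right_mono) auto
    finally show ?thesis .
  qed
  have 5: "\<rho>\<^sup>2 * y \<le> (\<epsilon> * \<rho> / 4) * y"
    using mult_right_mono[OF \<rho>(2), of \<rho>] \<rho>(1) y0
    by (intro mult_right_mono) (auto simp: power2_eq_square)
  \<comment> \<open>The budget behind \<open>K\<close>: M a for the Laplacian of \<delta>, 2 B M a
    for the defect \<tau>, and 2 M a left over for the conclusion. Of \<epsilon> \<rho> y one
    quarter goes to \<rho>^2 y and one quarter to \<open>4\<close>.\<close>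
  have 6: "K * a = 3 * (a * M) + 2 * (a * (B * M))" by (simp add: K algebra_simps)
  show ?thesis unfolding eq
    using 1 2 3 4 5 6 by (simp add: algebra_simps)
qed

text \<open>The weight w multiplies the estimate \<open>E\<close> and adds -\<nabla>w \<bullet> P =
  c \<epsilon> \<rho> y (x \<bullet> P), where x \<bullet> P = A s + b. The harm is at most c \<rho>
  y (N^2/4 + B), made small by \<open>c\<close>, plus a multiple of 1/\<delta> due to the curved
  boundary, for which the term 2 M a in \<open>E\<close> was reserved.\<close>

lemma weighted_estimate:
  fixes N \<epsilon> c K M B \<rho> d s a y A b w E :: real
  assumes M: "M \<ge> 1" and N: "N \<ge> 0" and \<epsilon>: "0 < \<epsilon>" "\<epsilon> \<le> 1" and \<rho>: "0 < \<rho>" "\<rho> \<le> 1"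
    and d: "d > 0" and B: "B = N / 2 + 1" and K: "K \<ge> 0"
    and a: "a = 1 / d" and y: "y > 0" and A: "A = a - K" and b: "b = - N / 2 - \<rho>"
    and Kd: "K * d \<le> 1" and s: "y * \<bar>s - d\<bar> \<le> M"
    and c: "0 < c" "c \<le> 1" "c * (N\<^sup>2 / 4 + B) \<le> \<epsilon> / 8" and w: "w = 1 - c * \<rho>" "w \<ge> 1 / 2"
    and E: "(N\<^sup>2 / 4 + \<epsilon> * \<rho> / 2) * y + 2 * M * a \<le> E"
  shows "(N\<^sup>2 / 4 + \<epsilon> * \<rho> / 8) * y \<le> w * E + c * \<epsilon> * \<rho> * y * (A * s + b)"
proof -
  define \<tau> where "\<tau> = s - d"
  have ad: "a * d = 1" and a0: "a > 0" using a d by auto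
  have Ka: "K \<le> a" using Kd d by (simp add: a field_simps)
  have A0: "0 \<le> A" "A \<le> a" using Ka K A by auto
  have "A * s = (1 - K * d) + A * \<tau>"
    using ad by (simp add: A \<tau>_def algebra_simps)
  then have "A * s + b \<ge> A * \<tau> - B"
    using Kd b B \<rho> by simp
  moreover have "A * \<tau> \<ge> - (a * \<bar>\<tau>\<bar>)"
  proof -
    have "\<bar>A * \<tau>\<bar> \<le> a * \<bar>\<tau>\<bar>" using A0 by (simp add: abs_mult mult_right_mono)
    then show ?thesis by linarith
  qed
  ultimately have "A * s + b \<ge> - (a * \<bar>\<tau>\<bar> + B)" by linarith
  then have "(c * \<epsilon> * \<rho> * y) * (A * s + b) \<ge> (c * \<epsilon> * \<rho> * y) * (- (a * \<bar>\<tau>\<bar> + B))"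
    using c \<epsilon> \<rho> y by (intro mult_left_mono) auto
  moreover have "(c * \<epsilon> * \<rho> * y) * (- (a * \<bar>\<tau>\<bar> + B))
      = - ((c * \<epsilon> * \<rho>) * (a * (y * \<bar>\<tau>\<bar>))) - \<epsilon> * (c * \<rho> * y * B)"
    by (simp add: algebra_simps)
  moreover have "(c * \<epsilon> * \<rho>) * (a * (y * \<bar>\<tau>\<bar>)) \<le> 1 * (a * M)"
  proof -
    have "c * \<epsilon> * \<rho> \<le> 1" using c \<epsilon> \<rho> by (simp add: mult_le_one)
    moreover have "a * (y * \<bar>\<tau>\<bar>) \<le> a * M" using s a0 by (simp add: \<tau>_def)
    ultimately show ?thesis using a0 y by (intro mult_mono) auto
  qed
  moreover have "\<epsilon> * (c * \<rho> * y * B) \<le> 1 * (c * \<rho> * y * B)"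
    using \<epsilon> c \<rho> y B N by (intro mult_right_mono) auto
  \<comment> \<open>The Hardy term is multiplied by w exactly, as it has no room for loss; for the
    two gains the crude bound w \<ge> 1/2 is enough.\<close>
  moreover have "w * E \<ge> (N\<^sup>2 / 4 * y - c * \<rho> * (N\<^sup>2 / 4) * y) + (\<epsilon> * \<rho> / 4 * y + M * a)"
  proof -
    have "w * E \<ge> w * ((N\<^sup>2 / 4 + \<epsilon> * \<rho> / 2) * y + 2 * M * a)"
      using E w by (intro mult_left_mono) auto
    moreover have "w * ((\<epsilon> * \<rho> / 2) * y + 2 * M * a) \<ge> (1 / 2) * ((\<epsilon> * \<rho> / 2) * y + 2 * M * a)"
      using w \<epsilon> \<rho> y M a0 by (intro mult_right_mono) auto
    moreover have "w * (N\<^sup>2 / 4 * y) = N\<^sup>2 / 4 * y - c * \<rho> * (N\<^sup>2 / 4) * y"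
      unfolding w(1) by (simp add: left_diff_distrib right_diff_distrib mult.commute mult.left_commute)
    ultimately show ?thesis by (simp add: algebra_simps)
  qed
  moreover have "(c * (N\<^sup>2 / 4 + B)) * (\<rho> * y) \<le> (\<epsilon> / 8) * (\<rho> * y)"
    using c \<rho> y by (intro mult_right_mono) auto
  ultimately show ?thesis by (simp add: algebra_simps)
qed

text \<open>Here \<chi> = p^2, t = x \<bullet> P and PP = |P|^2. The field is linear in \<chi> but
  |G|^2 / w is quadratic, so cutting off leaves the positive term w \<chi> (1 - \<chi>) |P|^2, which
  absorbs the term with \<nabla>\<chi>. The loss in the main term is at most 2 q X, bounded because
  q grows like the square of r while X is of order r^(-2).\<close>

lemma cutoff_estimate:
  fixes p q R r t PP X Y w :: real
  assumes R: "R > 0" and q: "q = r\<^sup>2 / R\<^sup>2" and p: "p = 1 - q" "0 \<le> p"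
    and t: "t\<^sup>2 \<le> r\<^sup>2 * PP" and PP: "PP \<ge> 0"
    and w: "0 \<le> w" "w \<le> 1" and X: "X \<le> Y" "X \<ge> 0" "q * X \<le> Z"
  shows "X - 2 * Z - 4 / R\<^sup>2 \<le> p\<^sup>2 * Y + w * ((4 / R\<^sup>2) * p * t + p\<^sup>2 * (1 - p\<^sup>2) * PP)"
proof -
  have q0: "q \<ge> 0" "q \<le> 1" using q p by auto
  have "p\<^sup>2 * q * PP \<le> p\<^sup>2 * (1 - p\<^sup>2) * PP"
  proof -
    have "q * 1 \<le> q * (1 + p)" using q0 p by (intro mult_left_mono) auto
    also have "q * (1 + p) = 1 - p\<^sup>2"
    proof -
      have q1: "q = 1 - p" using p(1) by simp
      show ?thesis unfolding q1 by (simp add: power2_eq_square algebra_simps)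
    qed
    finally show ?thesis using PP by (intro mult_right_mono mult_left_mono) auto
  qed
  moreover have "p\<^sup>2 * q * PP \<ge> p\<^sup>2 * t\<^sup>2 / R\<^sup>2"
  proof -
    have "p\<^sup>2 * t\<^sup>2 / R\<^sup>2 \<le> p\<^sup>2 * (r\<^sup>2 * PP) / R\<^sup>2"
      using t by (intro divide_right_mono mult_left_mono) auto
    then show ?thesis by (simp add: q mult.assoc)
  qed
  \<comment> \<open>Completing the square in p t; the constant 4 / R^2 is all that it costs.\<close>
  moreover have "(4 / R\<^sup>2) * p * t + p\<^sup>2 * t\<^sup>2 / R\<^sup>2 \<ge> - 4 / R\<^sup>2"
  proof -
    have "0 \<le> (p * t + 2)\<^sup>2 / R\<^sup>2" by simp
    also have "\<dots> = (4 / R\<^sup>2) * p * t + p\<^sup>2 * t\<^sup>2 / R\<^sup>2 + 4 / R\<^sup>2"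
      by (simp add: power2_eq_square add_divide_distrib[symmetric] algebra_simps)
    finally show ?thesis by simp
  qed
  ultimately have "(4 / R\<^sup>2) * p * t + p\<^sup>2 * (1 - p\<^sup>2) * PP \<ge> - 4 / R\<^sup>2" by linarith
  then have "w * ((4 / R\<^sup>2) * p * t + p\<^sup>2 * (1 - p\<^sup>2) * PP) \<ge> w * (- 4 / R\<^sup>2)"
    using w by (intro mult_left_mono)
  moreover have "w * (4 / R\<^sup>2) \<le> 1 * (4 / R\<^sup>2)" using w by (intro mult_right_mono) auto
  moreover have "p\<^sup>2 * Y \<ge> X - 2 * Z"
  proof -
    have "p\<^sup>2 * Y \<ge> p\<^sup>2 * X" using X by (intro mult_left_mono) auto
    moreover have "p\<^sup>2 * X = X - 2 * (q * X) + q\<^sup>2 * X" by (simp add: p power2_eq_square algebra_simps)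
    moreover have "q\<^sup>2 * X \<ge> 0" using X by simp
    ultimately show ?thesis using X(3) by linarith
  qed
  ultimately show ?thesis by simp
qed

section \<open>Derivatives of the radial factors and of the cutoff\<close>

lemma norm_powr_has_derivative:
  fixes x :: "'a::euclidean_space"
  assumes "x \<noteq> 0"
  shows "((\<lambda>x. norm x powr \<epsilon>) has_derivative
    (\<lambda>v. (\<epsilon> * norm x powr \<epsilon> / (norm x)\<^sup>2) * (x \<bullet> v))) (at x)"
proof -
  have "(norm has_derivative (\<lambda>v. v \<bullet> sgn x)) (at x)"
    using has_derivative_norm[OF assms] .
  from has_derivative_powr[OF this has_derivative_const, of \<epsilon>]
  have "((\<lambda>x. norm x powr \<epsilon>) has_derivative
      (\<lambda>v. norm x powr \<epsilon> * (0 * ln (norm x) + (v \<bullet> sgn x) * \<epsilon> / norm x))) (at x)"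
    using assms by simp
  moreover have "norm x powr \<epsilon> * (0 * ln (norm x) + (v \<bullet> sgn x) * \<epsilon> / norm x)
      = (\<epsilon> * norm x powr \<epsilon> / (norm x)\<^sup>2) * (x \<bullet> v)" for v
    by (simp add: sgn_div_norm inner_commute power2_eq_square field_simps)
  ultimately show ?thesis by simp
qed

lemma norm_square_has_derivative:
  "((\<lambda>x. (norm x)\<^sup>2) has_derivative (\<lambda>v. 2 * (x \<bullet> v))) (at (x::'a::euclidean_space))"
proof -
  have "((\<lambda>x. x \<bullet> x) has_derivative (\<lambda>v. x \<bullet> v + v \<bullet> x)) (at x)"
    by (rule has_derivative_inner[OF has_derivative_ident has_derivative_ident])
  then show ?thesis by (simp add: power2_norm_eq_inner inner_commute)
qed

lemma max_0_square_has_derivative: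
  "((\<lambda>t::real. (max 0 t)\<^sup>2) has_real_derivative 2 * max 0 t) (at t)"
proof -
  consider "t > 0" | "t < 0" | "t = 0" by linarith
  then show ?thesis
  proof cases
    case 1
    have "((\<lambda>t. t\<^sup>2) has_real_derivative 2 * max 0 t) (at t)"
      using 1 by (auto intro!: derivative_eq_intros)
    then show ?thesis
      by (rule has_field_derivative_transform_within_open[where S="{0<..}"]) (use 1 in auto)
  next
    case 2
    have "((\<lambda>t. 0) has_real_derivative 2 * max 0 t) (at t)"
      using 2 by simp
    then show ?thesis
      by (rule has_field_derivative_transform_within_open[where S="{..<0}"]) (use 2 in auto)
  next
    case 3
    have "((\<lambda>h::real. (max 0 h)\<^sup>2 / h) \<longlongrightarrow> 0) (at 0)"
    proof (rule Lim_null_comparison)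
      show "\<forall>\<^sub>F h::real in at 0. norm ((max 0 h)\<^sup>2 / h) \<le> \<bar>h\<bar>"
        by (intro always_eventually allI) (auto simp: max_def power2_eq_square)
      show "((\<lambda>h::real. \<bar>h\<bar>) \<longlongrightarrow> 0) (at 0)"
        by (rule tendsto_rabs_zero) (rule tendsto_ident_at)
    qed
    then show ?thesis using 3 by (simp add: DERIV_def)
  qed
qed

text \<open>The cutoff \<chi> is the square of this function. Squaring removes the kink at |x| = R,
  so \<chi> is C^1, which suffices for the field.\<close>

definition cutoff :: "real \<Rightarrow> 'a::euclidean_space \<Rightarrow> real" where
  "cutoff R x = max 0 (1 - (norm x)\<^sup>2 / R\<^sup>2)"

lemma cutoff_square_has_derivative:
  fixes x :: "'a::euclidean_space"
  shows "((\<lambda>x. (cutoff R x)\<^sup>2) has_derivative (\<lambda>v. (- (4 / R\<^sup>2) * cutoff R x) * (x \<bullet> v))) (at x)"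
proof -
  have "((\<lambda>x. 1 - (norm x)\<^sup>2 / R\<^sup>2) has_derivative (\<lambda>v. 0 - 2 * (x \<bullet> v) / R\<^sup>2)) (at x)"
    by (intro has_derivative_diff has_derivative_const norm_square_has_derivative
        bounded_linear.has_derivative[OF bounded_linear_divide])
  from DERIV_compose_FDERIV[OF max_0_square_has_derivative this]
  show ?thesis by (simp add: cutoff_def mult_ac)
qed

lemma continuous_on_cutoff: "continuous_on S (cutoff R)"
  unfolding cutoff_def[abs_def] divide_inverse by (intro continuous_intros)

text \<open>Multiplied by x this is the gradient of the logarithm of |x| powr (-N/2) exp (-|x| powr
  \<epsilon> / \<epsilon>); the division by \<epsilon> in the exponent cancels the factor from the
  derivative.\<close>

definition radial_coeff :: "real \<Rightarrow> 'a::euclidean_space \<Rightarrow> real" where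
  "radial_coeff \<epsilon> x = (- (real DIM('a) / 2) - norm x powr \<epsilon>) / (norm x)\<^sup>2"

definition radial_coeff_deriv :: "real \<Rightarrow> 'a::euclidean_space \<Rightarrow> real" where
  "radial_coeff_deriv \<epsilon> x = (real DIM('a) + (2 - \<epsilon>) * norm x powr \<epsilon>) / (norm x) ^ 4"

lemma radial_coeff_has_derivative:
  fixes x :: "'a::euclidean_space"
  assumes "x \<noteq> 0"
  shows "(radial_coeff \<epsilon> has_derivative (\<lambda>v. radial_coeff_deriv \<epsilon> x * (x \<bullet> v))) (at x)"
proof -
  have "(radial_coeff \<epsilon> has_derivative (\<lambda>v.
     ((0 - (\<epsilon> * norm x powr \<epsilon> / (norm x)\<^sup>2) * (x \<bullet> v)) * (norm x)\<^sup>2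
       - (- (real DIM('a) / 2) - norm x powr \<epsilon>) * (2 * (x \<bullet> v))) / ((norm x)\<^sup>2 * (norm x)\<^sup>2))) (at x)"
    unfolding radial_coeff_def[abs_def]
    by (intro has_derivative_divide' has_derivative_diff has_derivative_const
        norm_powr_has_derivative norm_square_has_derivative) (use assms in auto)
  moreover have "((0 - (\<epsilon> * norm x powr \<epsilon> / (norm x)\<^sup>2) * (x \<bullet> v)) * (norm x)\<^sup>2
       - (- (real DIM('a) / 2) - norm x powr \<epsilon>) * (2 * (x \<bullet> v))) / ((norm x)\<^sup>2 * (norm x)\<^sup>2)
     = radial_coeff_deriv \<epsilon> x * (x \<bullet> v)" for v
  proof -
    have "(norm x)\<^sup>2 * (norm x)\<^sup>2 = (norm x) ^ 4" by (simp add: power_add[symmetric])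
    moreover have "(0 - (\<epsilon> * norm x powr \<epsilon> / (norm x)\<^sup>2) * (x \<bullet> v)) * (norm x)\<^sup>2
        = - (\<epsilon> * norm x powr \<epsilon> * (x \<bullet> v))" using assms by simp
    ultimately show ?thesis
      by (simp add: radial_coeff_deriv_def algebra_simps)
  qed
  ultimately show ?thesis by simp
qed

definition radial_weight :: "real \<Rightarrow> real \<Rightarrow> 'a::euclidean_space \<Rightarrow> real" where
  "radial_weight c \<epsilon> x = 1 - c * norm x powr \<epsilon>"

text \<open>This is \<open>\<nabla>\<psi> / \<psi>\<close>, with \<open>f\<close> for the boundary defining function.\<close>

definition log_gradient :: "('a::euclidean_space \<Rightarrow> real) \<Rightarrow> real \<Rightarrow> real \<Rightarrow> 'a \<Rightarrow> 'a" where
  "log_gradient f K \<epsilon> x = (1 / f x - K) *\<^sub>R gradient f x + radial_coeff \<epsilon> x *\<^sub>R x"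

definition log_gradient_deriv :: "('a::euclidean_space \<Rightarrow> real) \<Rightarrow> real \<Rightarrow> real \<Rightarrow> 'a \<Rightarrow> 'a \<Rightarrow> 'a" where
  "log_gradient_deriv f K \<epsilon> x v =
    ((1 / f x - K) *\<^sub>R hessian f x v + (- (gradient f x \<bullet> v) / (f x)\<^sup>2) *\<^sub>R gradient f x)
    + (radial_coeff \<epsilon> x *\<^sub>R v + (radial_coeff_deriv \<epsilon> x * (x \<bullet> v)) *\<^sub>R x)"

lemma log_gradient_has_derivative:
  assumes "smooth f" "x \<noteq> 0" "f x \<noteq> 0"
  shows "(log_gradient f K \<epsilon> has_derivative log_gradient_deriv f K \<epsilon> x) (at x)"
proof -
  have "((\<lambda>x. 1 / f x - K) has_derivative (\<lambda>v. - (gradient f x \<bullet> v) / (f x)\<^sup>2)) (at x)"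
  proof -
    have "((\<lambda>x. 1 / f x - K) has_derivative
       (\<lambda>v. (0 * f x - 1 * (gradient f x \<bullet> v)) / (f x * f x) - 0)) (at x)"
      by (intro has_derivative_diff has_derivative_divide' has_derivative_const
          smooth_has_gradient assms)
    then show ?thesis by (simp add: power2_eq_square)
  qed
  then show ?thesis
    unfolding log_gradient_def[abs_def] log_gradient_deriv_def[abs_def]
    by (intro has_derivative_add has_derivative_scaleR has_derivative_ident
        smooth_gradient_has_derivative radial_coeff_has_derivative assms)
qed

lemma divergence_simps:
  "divergence (\<lambda>v. L v + M v) = divergence L + divergence M"
  "divergence (\<lambda>v. - L v) = - divergence L"
  "divergence (\<lambda>v. c *\<^sub>R L v) = c * divergence L"
  "divergence (\<lambda>v. (c * (a \<bullet> v)) *\<^sub>R b) = c * (a \<bullet> b)"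
  "divergence (\<lambda>v. v :: 'a::euclidean_space) = real DIM('a)"
  by (simp_all add: divergence_def inner_add_left sum.distrib sum_negf sum_distrib_left inner_Basis
      mult.assoc euclidean_inner[of a b] inner_commute[of b])

text \<open>The shape is that of \<open>riccati_estimate\<close>, with 1 / f x for \<open>a\<close>
  and 1 / |x|^2 for \<open>y\<close>. The trace of the rank-one part contributes x \<bullet> x,
  which lowers the fourth power in \<open>radial_coeff_deriv\<close> to a square.\<close>

lemma divergence_log_gradient_deriv:
  fixes x :: "'a::euclidean_space"
  assumes "x \<noteq> 0"
  shows "divergence (log_gradient_deriv f K \<epsilon> x) =
    - (norm (gradient f x))\<^sup>2 * (1 / f x)\<^sup>2 + (1 / f x - K) * divergence (hessian f x)
    + (real DIM('a) + (2 - \<epsilon>) * norm x powr \<epsilon>) * (1 / (norm x)\<^sup>2)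
    + real DIM('a) * (- (real DIM('a)) / 2 - norm x powr \<epsilon>) * (1 / (norm x)\<^sup>2)"
proof -
  have "log_gradient_deriv f K \<epsilon> x = (\<lambda>v.
    ((1 / f x - K) *\<^sub>R hessian f x v + ((- (1 / (f x)\<^sup>2)) * (gradient f x \<bullet> v)) *\<^sub>R gradient f x)
    + (radial_coeff \<epsilon> x *\<^sub>R v + (radial_coeff_deriv \<epsilon> x * (x \<bullet> v)) *\<^sub>R x))"
    by (simp add: fun_eq_iff log_gradient_deriv_def)
  then have "divergence (log_gradient_deriv f K \<epsilon> x) =
    ((1 / f x - K) * divergence (hessian f x) + (- (1 / (f x)\<^sup>2)) * (gradient f x \<bullet> gradient f x))
    + (radial_coeff \<epsilon> x * real DIM('a) + radial_coeff_deriv \<epsilon> x * (x \<bullet> x))"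
    by (simp only: divergence_simps)
  moreover have "radial_coeff_deriv \<epsilon> x * (x \<bullet> x)
      = (real DIM('a) + (2 - \<epsilon>) * norm x powr \<epsilon>) * (1 / (norm x)\<^sup>2)"
    using assms by (simp add: radial_coeff_deriv_def power2_norm_eq_inner[symmetric] power4_eq_xxxx power2_eq_square)
  moreover have "radial_coeff \<epsilon> x * real DIM('a)
      = real DIM('a) * (- (real DIM('a)) / 2 - norm x powr \<epsilon>) * (1 / (norm x)\<^sup>2)"
    by (simp add: radial_coeff_def)
  ultimately show ?thesis
    by (simp add: power2_norm_eq_inner power_divide)
qed

section \<open>The cut-off field and its pointwise lower bound\<close>

definition hardy_field :: "('a::euclidean_space \<Rightarrow> real) \<Rightarrow> real \<Rightarrow> real \<Rightarrow> real \<Rightarrow> real \<Rightarrow> 'a \<Rightarrow> 'a" where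
  "hardy_field f K \<epsilon> c R x = - ((radial_weight c \<epsilon> x * (cutoff R x)\<^sup>2) *\<^sub>R log_gradient f K \<epsilon> x)"

definition hardy_field_deriv ::
  "('a::euclidean_space \<Rightarrow> real) \<Rightarrow> real \<Rightarrow> real \<Rightarrow> real \<Rightarrow> real \<Rightarrow> 'a \<Rightarrow> 'a \<Rightarrow> 'a" where
  "hardy_field_deriv f K \<epsilon> c R x v =
    - ((radial_weight c \<epsilon> x * (cutoff R x)\<^sup>2) *\<^sub>R log_gradient_deriv f K \<epsilon> x v
       + ((radial_weight c \<epsilon> x * (- (4 / R\<^sup>2) * cutoff R x)
            + (- (c * \<epsilon> * norm x powr \<epsilon> / (norm x)\<^sup>2)) * (cutoff R x)\<^sup>2) * (x \<bullet> v))
         *\<^sub>R log_gradient f K \<epsilon> x)"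

lemma hardy_field_has_derivative:
  assumes "smooth f" "x \<noteq> 0" "f x \<noteq> 0"
  shows "(hardy_field f K \<epsilon> c R has_derivative hardy_field_deriv f K \<epsilon> c R x) (at x)"
proof -
  have "(radial_weight c \<epsilon> has_derivative (\<lambda>v. (- (c * \<epsilon> * norm x powr \<epsilon> / (norm x)\<^sup>2)) * (x \<bullet> v))) (at x)"
  proof -
    have "(radial_weight c \<epsilon> has_derivative
        (\<lambda>v. 0 - c * ((\<epsilon> * norm x powr \<epsilon> / (norm x)\<^sup>2) * (x \<bullet> v)))) (at x)"
      unfolding radial_weight_def[abs_def]
      by (intro has_derivative_diff has_derivative_const has_derivative_mult_right
          norm_powr_has_derivative assms)
    then show ?thesis by (simp add: mult.assoc)
  qed
  from has_derivative_mult[OF this cutoff_square_has_derivative[of R x]]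
  have "((\<lambda>x. radial_weight c \<epsilon> x * (cutoff R x)\<^sup>2) has_derivative
     (\<lambda>v. (radial_weight c \<epsilon> x * (- (4 / R\<^sup>2) * cutoff R x)
            + (- (c * \<epsilon> * norm x powr \<epsilon> / (norm x)\<^sup>2)) * (cutoff R x)\<^sup>2) * (x \<bullet> v))) (at x)"
    by (simp add: algebra_simps)
  from has_derivative_minus[OF has_derivative_scaleR[OF this log_gradient_has_derivative[OF assms, of K \<epsilon>]]]
  show ?thesis
    by (simp add: hardy_field_def[abs_def] hardy_field_deriv_def[abs_def])
qed

text \<open>Beyond radius R nothing is known about the sign of f; there the field continues as
  zero.\<close>

lemma hardy_field_deriv_eq_0: "cutoff R x = 0 \<Longrightarrow> hardy_field_deriv f K \<epsilon> c R x = (\<lambda>v. 0)"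
  by (simp add: fun_eq_iff hardy_field_deriv_def)

lemma hardy_field_eq_0: "cutoff R x = 0 \<Longrightarrow> hardy_field f K \<epsilon> c R x = 0"
  by (simp add: hardy_field_def)

lemma divergence_hardy_field_deriv:
  "divergence (hardy_field_deriv f K \<epsilon> c R x) =
    - (radial_weight c \<epsilon> x * (cutoff R x)\<^sup>2 * divergence (log_gradient_deriv f K \<epsilon> x)
       + (radial_weight c \<epsilon> x * (- (4 / R\<^sup>2) * cutoff R x)
            + (- (c * \<epsilon> * norm x powr \<epsilon> / (norm x)\<^sup>2)) * (cutoff R x)\<^sup>2) * (x \<bullet> log_gradient f K \<epsilon> x))"
  unfolding hardy_field_deriv_def[abs_def] divergence_simps by simp

lemma hardy_field_deriv_continuous:
  assumes sm: "smooth f" and U: "\<And>x. x \<in> U \<Longrightarrow> x \<noteq> 0" "\<And>x. x \<in> U \<Longrightarrow> f x \<noteq> 0"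
  shows "continuous_on U (\<lambda>x. hardy_field_deriv f K \<epsilon> c R x v)"
proof -
  note [continuous_intros] = continuous_on_subset[OF smooth_continuous[OF sm] subset_UNIV]
    continuous_on_subset[OF smooth_continuous_gradient[OF sm] subset_UNIV]
    continuous_on_subset[OF smooth_continuous_hessian[OF sm] subset_UNIV] continuous_on_cutoff
  have p[continuous_intros]: "continuous_on U (\<lambda>x. norm x powr \<epsilon>)"
    using U(1) by (intro continuous_intros) auto
  have rc[continuous_intros]: "continuous_on U (radial_coeff \<epsilon>)" "continuous_on U (radial_coeff_deriv \<epsilon>)"
    unfolding radial_coeff_def[abs_def] radial_coeff_deriv_def[abs_def]
    using U(1) by (intro continuous_intros; auto)+
  have lg[continuous_intros]: "continuous_on U (log_gradient f K \<epsilon>)"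
     "continuous_on U (\<lambda>x. log_gradient_deriv f K \<epsilon> x v)"
    unfolding log_gradient_def[abs_def] log_gradient_deriv_def
    using U(2) by (intro continuous_intros; auto)+
  show ?thesis
    unfolding hardy_field_deriv_def radial_weight_def
    using U(1) by (intro continuous_intros) auto
qed

lemma hardy_pointwise:
  fixes x :: "'a::euclidean_space" and N \<rho> \<epsilon> :: real
  assumes N_def: "N = real DIM('a)" and \<rho>_def: "\<rho> = norm x powr \<epsilon>"
    and x: "x \<noteq> 0" "norm x \<le> R" and R: "R > 0" and f: "f x > 0"
    and M: "M \<ge> 1" and \<epsilon>: "0 < \<epsilon>" "\<epsilon> \<le> 1" and \<rho>: "\<rho> \<le> \<epsilon> / 4" "\<rho> \<le> 1"
    and B: "B = N / 2 + 1" and K: "K = 3 * M + 2 * B * M"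
    and Kd: "K * f x \<le> 1" and small: "8 * B * K * M * norm x \<le> \<epsilon> * \<rho>"
    and g: "norm (gradient f x) \<ge> 1"
    and L: "\<bar>divergence (hessian f x)\<bar> \<le> M"
    and s: "\<bar>gradient f x \<bullet> x - f x\<bar> \<le> M * (norm x)\<^sup>2"
    and fM: "f x \<le> M * norm x"
    and c: "0 < c" "c \<le> 1" "c * (N\<^sup>2 / 4 + B) \<le> \<epsilon> / 8" and w: "radial_weight c \<epsilon> x \<ge> 1 / 2"
  shows "(N\<^sup>2 / 4 + \<epsilon> * \<rho> / 8) / (norm x)\<^sup>2 - 2 * ((N\<^sup>2 / 4 + 1) / R\<^sup>2) - 4 / R\<^sup>2
    \<le> divergence (hardy_field_deriv f K \<epsilon> c R x)
      - (norm (hardy_field f K \<epsilon> c R x))\<^sup>2 / radial_weight c \<epsilon> x"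
proof -
  define r where "r = norm x"
  define y where "y = 1 / r\<^sup>2"
  define a where "a = 1 / f x"
  define A where "A = a - K"
  define b where "b = - N / 2 - \<rho>"
  define sx where "sx = gradient f x \<bullet> x"
  define dd where "dd = (norm (gradient f x))\<^sup>2"
  define Lx where "Lx = divergence (hessian f x)"
  define wx where "wx = radial_weight c \<epsilon> x"
  define p where "p = cutoff R x"
  define P where "P = log_gradient f K \<epsilon> x"
  define PP where "PP = A\<^sup>2 * dd + 2 * A * b * y * sx + b\<^sup>2 * y"
  define dP where "dP = - dd * a\<^sup>2 + A * Lx + (N + (2 - \<epsilon>) * \<rho>) * y + N * b * y"
  have r: "r > 0" and y0: "y > 0" and yr: "y * r\<^sup>2 = 1" using x by (auto simp: r_def y_def)
  have N: "N \<ge> 0" by (simp add: N_def)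
  have \<rho>0: "\<rho> > 0" using x by (simp add: \<rho>_def)
  have B0: "B \<ge> 1" using B N by simp
  have K0: "K \<ge> 0" using K M B0 by simp
  have dd1: "dd \<ge> 1" using g by (simp add: dd_def)
  have rc: "radial_coeff \<epsilon> x = b * y"
    by (simp add: radial_coeff_def b_def y_def r_def N_def \<rho>_def)
  have P: "P = A *\<^sub>R gradient f x + (b * y) *\<^sub>R x"
    by (simp add: P_def log_gradient_def rc A_def a_def)
  have xx: "x \<bullet> x = r\<^sup>2" by (simp add: r_def power2_norm_eq_inner)
  have gx: "gradient f x \<bullet> x = sx" "x \<bullet> gradient f x = sx" "gradient f x \<bullet> gradient f x = dd"
    by (simp_all add: sx_def dd_def power2_norm_eq_inner inner_commute)
  have PPeq: "(norm P)\<^sup>2 = PP"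
  proof -
    have "(norm P)\<^sup>2 = A\<^sup>2 * dd + 2 * (A * (b * y) * sx) + (b * y)\<^sup>2 * r\<^sup>2"
      unfolding P power2_norm_eq_inner
      by (simp add: inner_add_left inner_add_right xx gx power2_eq_square algebra_simps)
    also have "(b * y)\<^sup>2 * r\<^sup>2 = b\<^sup>2 * y * (y * r\<^sup>2)" by (simp add: power2_eq_square)
    finally show ?thesis unfolding yr PP_def by simp
  qed
  have xP: "x \<bullet> P = A * sx + b"
  proof -
    have "x \<bullet> P = A * sx + b * (y * r\<^sup>2)"
      unfolding P by (simp add: inner_add_right xx gx)
    then show ?thesis unfolding yr by simp
  qed
  have dPeq: "divergence (log_gradient_deriv f K \<epsilon> x) = dP"
    unfolding divergence_log_gradient_deriv[OF x(1)] dP_def dd_def a_def A_def Lx_def y_def b_def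
      r_def N_def \<rho>_def by simp
  have 1: "(N\<^sup>2 / 4 + \<epsilon> * \<rho> / 2) * y + 2 * M * a \<le> - dP - PP"
    unfolding dP_def PP_def
    by (rule riccati_estimate[where r=r and d="f x" and B=B and M=M and K=K])
       (use M N \<epsilon> \<rho>0 \<rho> r f B K fM Kd small dd1 L s in
         \<open>auto simp: a_def y_def A_def b_def sx_def Lx_def r_def\<close>)
  have ys: "y * \<bar>sx - f x\<bar> \<le> M"
  proof -
    have "y * \<bar>sx - f x\<bar> \<le> y * (M * r\<^sup>2)"
      using s y0 by (intro mult_left_mono) (auto simp: sx_def r_def)
    then show ?thesis using yr by (simp add: algebra_simps)
  qed
  have weq: "wx = 1 - c * \<rho>" by (simp add: wx_def radial_weight_def \<rho>_def)
  have 2: "(N\<^sup>2 / 4 + \<epsilon> * \<rho> / 8) * y \<le> wx * (- dP - PP) + c * \<epsilon> * \<rho> * y * (A * sx + b)"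
    by (rule weighted_estimate[where M=M and d="f x" and K=K and B=B and a=a])
       (use M N \<epsilon> \<rho>0 \<rho> f B K0 y0 Kd ys c w[folded wx_def] weq 1 in
         \<open>auto simp: a_def A_def b_def\<close>)
  have pq: "p = 1 - r\<^sup>2 / R\<^sup>2" "0 \<le> p"
  proof -
    have "r\<^sup>2 \<le> R\<^sup>2" using x(2) r by (auto simp: r_def intro: power_mono)
    then show "p = 1 - r\<^sup>2 / R\<^sup>2" using R by (simp add: p_def cutoff_def r_def)
    show "0 \<le> p" by (simp add: p_def cutoff_def)
  qed
  have w1: "0 \<le> wx" "wx \<le> 1" "wx > 0" using w c \<rho>0 by (auto simp: wx_def radial_weight_def \<rho>_def)
  have 3: "(N\<^sup>2 / 4 + \<epsilon> * \<rho> / 8) * y - 2 * ((N\<^sup>2 / 4 + 1) / R\<^sup>2) - 4 / R\<^sup>2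
    \<le> p\<^sup>2 * (wx * (- dP - PP) + c * \<epsilon> * \<rho> * y * (A * sx + b))
      + wx * ((4 / R\<^sup>2) * p * (A * sx + b) + p\<^sup>2 * (1 - p\<^sup>2) * PP)"
  proof (rule cutoff_estimate[where q="r\<^sup>2 / R\<^sup>2" and r=r])
    have "(A * sx + b)\<^sup>2 = \<bar>x \<bullet> P\<bar>\<^sup>2" by (simp add: xP)
    also have "\<dots> \<le> (norm x * norm P)\<^sup>2"
      by (intro power_mono Cauchy_Schwarz_ineq2) auto
    finally show "(A * sx + b)\<^sup>2 \<le> r\<^sup>2 * PP" by (simp add: power_mult_distrib PPeq r_def)
    show "0 \<le> PP" using PPeq by (metis zero_le_power2)
    show "0 \<le> (N\<^sup>2 / 4 + \<epsilon> * \<rho> / 8) * y" using \<epsilon> \<rho>0 y0 by simp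
    \<comment> \<open>Since q y = 1 / R^2, this bounds q times the potential by a constant, the
      \<open>Z\<close> of the cutoff estimate.\<close>
    have "\<epsilon> * \<rho> \<le> 1" using \<epsilon> \<rho> \<rho>0 by (simp add: mult_le_one)
    then have "(N\<^sup>2 / 4 + \<epsilon> * \<rho> / 8) / R\<^sup>2 \<le> (N\<^sup>2 / 4 + 1) / R\<^sup>2"
      by (intro divide_right_mono) auto
    then show "r\<^sup>2 / R\<^sup>2 * ((N\<^sup>2 / 4 + \<epsilon> * \<rho> / 8) * y) \<le> (N\<^sup>2 / 4 + 1) / R\<^sup>2"
      using yr r by (simp add: y_def)
  qed (use R pq w1 2 in auto)
  have G2: "(norm (hardy_field f K \<epsilon> c R x))\<^sup>2 / radial_weight c \<epsilon> x = wx * (p\<^sup>2 * p\<^sup>2 * PP)"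
  proof -
    have "(norm (hardy_field f K \<epsilon> c R x))\<^sup>2 = (wx * p\<^sup>2)\<^sup>2 * PP"
      by (simp add: hardy_field_def wx_def[symmetric] p_def[symmetric] P_def[symmetric] PPeq[symmetric]
          power_mult_distrib)
    then show ?thesis using w1(3) by (simp add: wx_def[symmetric] power2_eq_square)
  qed
  have G1: "divergence (hardy_field_deriv f K \<epsilon> c R x) =
      - (wx * p\<^sup>2 * dP + (wx * (- (4 / R\<^sup>2) * p) + (- (c * \<epsilon> * \<rho> * y)) * p\<^sup>2) * (A * sx + b))"
    unfolding divergence_hardy_field_deriv dPeq P_def[symmetric] xP
    by (simp add: wx_def p_def \<rho>_def y_def r_def)
  \<comment> \<open>With \<chi> = p^2 both sides are \<chi> (w (-div P - |P|^2) - \<nabla>w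
    \<bullet> P) + w (-\<nabla>\<chi> \<bullet> P + \<chi> (1 - \<chi>) |P|^2).\<close>
  have "p\<^sup>2 * (wx * (- dP - PP) + c * \<epsilon> * \<rho> * y * (A * sx + b))
      + wx * ((4 / R\<^sup>2) * p * (A * sx + b) + p\<^sup>2 * (1 - p\<^sup>2) * PP)
    = divergence (hardy_field_deriv f K \<epsilon> c R x)
      - (norm (hardy_field f K \<epsilon> c R x))\<^sup>2 / radial_weight c \<epsilon> x"
    unfolding G1 G2 by (simp add: algebra_simps)
  then show ?thesis using 3 by (simp add: y_def r_def)
qed

text \<open>The order of choices matters: f fixes M, then B and K; these and \<epsilon> determine R;
  \<open>c\<close> depends on \<epsilon>, the dimension and the size of \<Omega>. Whatever happens
  outside radius R goes into C.\<close>

lemma hardy_field_exists: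
  fixes \<Omega> :: "'a::euclidean_space set"
  assumes op: "open \<Omega>" and bd: "bounded \<Omega>" and sb: "smooth_boundary \<Omega>" and fr: "0 \<in> frontier \<Omega>"
    and \<epsilon>: "0 < \<epsilon>" "\<epsilon> < 1"
  obtains c C and G :: "'a \<Rightarrow> 'a" and G' where "c > 0" "C > 0"
    "\<And>x. x \<in> \<Omega> \<Longrightarrow> (G has_derivative G' x) (at x)"
    "\<And>v. continuous_on \<Omega> (\<lambda>x. G' x v)"
    "\<And>x. x \<in> \<Omega> \<Longrightarrow> radial_weight c \<epsilon> x \<ge> 1 / 2"
    "\<And>x. x \<in> \<Omega> \<Longrightarrow> ((real DIM('a))\<^sup>2 / 4 + \<epsilon> * norm x powr \<epsilon> / 8) / (norm x)\<^sup>2 - C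
      \<le> divergence (G' x) - (norm (G x))\<^sup>2 / radial_weight c \<epsilon> x"
proof -
  define N where "N = real DIM('a)"
  have N: "N \<ge> 0" by (simp add: N_def)
  obtain f r0 where f: "smooth f" "f 0 = 0" "r0 > 0"
    "\<And>x. x \<in> \<Omega> \<Longrightarrow> norm x < r0 \<Longrightarrow> f x > 0" "\<And>x. norm (gradient f x) \<ge> 1"
    using boundary_defining_function[OF op sb fr] by metis
  obtain M where M: "M \<ge> 1"
    "\<And>x. norm x \<le> 1 \<Longrightarrow> \<bar>divergence (hessian f x)\<bar> \<le> M"
    "\<And>x. norm x \<le> 1 \<Longrightarrow> \<bar>gradient f x \<bullet> x - f x\<bar> \<le> M * (norm x)\<^sup>2"
    "\<And>x. norm x \<le> 1 \<Longrightarrow> \<bar>f x\<bar> \<le> M * norm x"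
    using smooth_local_bounds[OF f(1,2)] by metis
  define B where "B = N / 2 + 1"
  define K where "K = 3 * M + 2 * B * M"
  have B0: "B \<ge> 1" using N by (simp add: B_def)
  have K0: "K \<ge> 0" using M(1) B0 by (simp add: K_def)
  obtain Dm where Dm: "Dm \<ge> 1" "\<And>x. x \<in> \<Omega> \<Longrightarrow> norm x \<le> Dm"
  proof -
    obtain b where "b > 0" "\<forall>x\<in>\<Omega>. norm x \<le> b" using bd bounded_pos by blast
    then show ?thesis by (intro that[of "max 1 b"]) (auto simp: le_max_iff_disj)
  qed
  have "0 \<notin> \<Omega>" using fr op by (simp add: frontier_def interior_open)
  then have n0: "x \<noteq> 0" if "x \<in> \<Omega>" for x using that by blast
  \<comment> \<open>Four conditions on the radius: \<rho> \<le> \<epsilon> / 4; the smallness that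
    absorbs the K/|x| error, where \<epsilon> < 1 enters; K f \<le> 1, by f \<le> M |x|; and
    validity of the local bounds and of f > 0.\<close>
  have "\<forall>\<^sub>F r in at_right 0. r powr \<epsilon> < \<epsilon> / 4"
  proof (rule order_tendstoD(2))
    show "((\<lambda>r. r powr \<epsilon>) \<longlongrightarrow> 0) (at_right 0)"
      by (rule tendsto_zero_powrI[of _ _ _ \<epsilon>])
         (use \<epsilon> in \<open>auto intro!: tendsto_ident_at eventually_at_right_less[THEN eventually_mono]\<close>)
  qed (use \<epsilon> in auto)
  moreover have "\<forall>\<^sub>F r in at_right 0. 8 * B * K * M * r powr (1 - \<epsilon>) < \<epsilon>"
  proof (rule order_tendstoD(2))
    have "((\<lambda>r. r powr (1 - \<epsilon>)) \<longlongrightarrow> 0) (at_right 0)"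
      by (rule tendsto_zero_powrI[of _ _ _ "1 - \<epsilon>"])
         (use \<epsilon> in \<open>auto intro!: tendsto_ident_at eventually_at_right_less[THEN eventually_mono]\<close>)
    then show "((\<lambda>r. 8 * B * K * M * r powr (1 - \<epsilon>)) \<longlongrightarrow> 0) (at_right 0)"
      by (rule tendsto_mult_right_zero)
  qed (use \<epsilon> in auto)
  moreover have "\<forall>\<^sub>F r in at_right 0. K * M * r < 1"
  proof (rule order_tendstoD(2))
    show "((\<lambda>r. K * M * r) \<longlongrightarrow> 0) (at_right 0)"
      by (rule tendsto_mult_right_zero[OF tendsto_ident_at])
  qed auto
  moreover have "\<forall>\<^sub>F r in at_right 0. r < min 1 r0"
    by (rule order_tendstoD(2)[OF tendsto_ident_at]) (use f(3) in auto)
  ultimately have "\<forall>\<^sub>F r in at_right 0. r powr \<epsilon> < \<epsilon> / 4 \<and> 8 * B * K * M * r powr (1 - \<epsilon>) < \<epsilon>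
      \<and> K * M * r < 1 \<and> r < min 1 r0"
    by eventually_elim auto
  then obtain R1 where R1: "R1 > 0" "\<And>r. 0 < r \<Longrightarrow> r < R1 \<Longrightarrow> r powr \<epsilon> < \<epsilon> / 4
      \<and> 8 * B * K * M * r powr (1 - \<epsilon>) < \<epsilon> \<and> K * M * r < 1 \<and> r < min 1 r0"
    unfolding eventually_at_right_field by auto
  \<comment> \<open>Halving makes R < r0, so that \<open>ball 0 r0\<close> and the exterior of
    radius R overlap and cover the space.\<close>
  define R where "R = R1 / 2"
  have R: "R > 0" "R < R1" "R < r0" using R1(1) R1(2)[of R] by (auto simp: R_def)
  define rm where "rm = Dm powr \<epsilon>"
  have rm1: "rm \<ge> 1" using Dm \<epsilon> by (simp add: rm_def ge_one_powr_ge_zero)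
  have rm: "norm x powr \<epsilon> \<le> rm" if "x \<in> \<Omega>" for x
    using Dm(2)[OF that] \<epsilon> by (auto simp: rm_def intro: powr_mono2)
  \<comment> \<open>The middle bound is the demand of \<open>weighted_estimate\<close>; the last one
    keeps the weight at least 1/2 on all of \<Omega>, also beyond the cutoff.\<close>
  define c where "c = min (min 1 (\<epsilon> / 8 / (N\<^sup>2 / 4 + B))) (1 / (2 * rm))"
  have NB: "N\<^sup>2 / 4 + B > 0" using B0 by (simp add: add_nonneg_pos)
  have c: "0 < c" "c \<le> 1" "c * (N\<^sup>2 / 4 + B) \<le> \<epsilon> / 8" "c * rm \<le> 1 / 2"
  proof -
    show "0 < c" using \<epsilon> NB rm1 by (simp add: c_def)
    show "c \<le> 1" by (simp add: c_def)
    have "c \<le> \<epsilon> / 8 / (N\<^sup>2 / 4 + B)" by (simp add: c_def)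
    then show "c * (N\<^sup>2 / 4 + B) \<le> \<epsilon> / 8" using NB by (simp only: pos_le_divide_eq)
    have "c \<le> 1 / (2 * rm)" by (simp add: c_def)
    then show "c * rm \<le> 1 / 2" using rm1 by (simp add: field_simps)
  qed
  have w: "radial_weight c \<epsilon> x \<ge> 1 / 2" if "x \<in> \<Omega>" for x
  proof -
    have "c * norm x powr \<epsilon> \<le> c * rm" using rm[OF that] c by (intro mult_left_mono) auto
    then show ?thesis using c(4) unfolding radial_weight_def by linarith
  qed
  \<comment> \<open>The first two terms are the cost of the cutoff inside radius R; the third bounds
    the potential outside, where the field vanishes.\<close>
  define C where "C = 2 * ((N\<^sup>2 / 4 + 1) / R\<^sup>2) + 4 / R\<^sup>2 + (N\<^sup>2 / 4 + rm) / R\<^sup>2"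
  have C0: "2 * ((N\<^sup>2 / 4 + 1) / R\<^sup>2) \<ge> 0" "4 / R\<^sup>2 > 0" "(N\<^sup>2 / 4 + rm) / R\<^sup>2 \<ge> 0"
    using R rm1 by auto
  then have C: "C > 0" unfolding C_def by linarith
  define G where "G = hardy_field f K \<epsilon> c R"
  define G' where "G' = hardy_field_deriv f K \<epsilon> c R"
  have cut0: "cutoff R x = 0" if "norm x \<ge> R" for x :: 'a
  proof -
    have "R\<^sup>2 \<le> (norm x)\<^sup>2" using that R by (intro power_mono) auto
    then show ?thesis using R by (simp add: cutoff_def)
  qed
  have opR: "open {x::'a. R < norm x}"
    by (intro open_Collect_less continuous_intros)
  show ?thesis
  proof (rule that[OF c(1) C])
    fix x assume x: "x \<in> \<Omega>"
    show "(G has_derivative G' x) (at x)"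
    proof (cases "norm x < r0")
      case True
      then show ?thesis unfolding G_def G'_def
        using f(4)[OF x True] by (intro hardy_field_has_derivative f n0 x) auto
    next
      case False
      then have xR: "x \<in> {x. R < norm x}" using R by simp
      then have "((\<lambda>x. 0) has_derivative G' x) (at x)"
        unfolding G'_def by (subst hardy_field_deriv_eq_0) (auto intro: cut0)
      then show ?thesis
        by (rule has_derivative_transform_within_open[OF _ opR xR])
           (auto simp: G_def hardy_field_eq_0 cut0)
    qed
    show "radial_weight c \<epsilon> x \<ge> 1 / 2" using w[OF x] .
    show "((real DIM('a))\<^sup>2 / 4 + \<epsilon> * norm x powr \<epsilon> / 8) / (norm x)\<^sup>2 - C
      \<le> divergence (G' x) - (norm (G x))\<^sup>2 / radial_weight c \<epsilon> x"
    proof (cases "norm x \<le> R")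
      case True
      have r: "norm x > 0" "norm x < R1" "norm x < r0" "norm x \<le> 1"
        using n0[OF x] True R R1(2)[of "norm x"] by auto
      note R1x = R1(2)[OF r(1,2)]
      have small: "8 * B * K * M * norm x \<le> \<epsilon> * norm x powr \<epsilon>"
      proof -
        have "norm x = norm x powr (1 - \<epsilon>) * norm x powr \<epsilon>"
          using r by (simp add: powr_add[symmetric])
        then have "8 * B * K * M * norm x = (8 * B * K * M * norm x powr (1 - \<epsilon>)) * norm x powr \<epsilon>"
          by (metis mult.assoc)
        also have "\<dots> \<le> \<epsilon> * norm x powr \<epsilon>"
          using R1x by (intro mult_right_mono) auto
        finally show ?thesis .
      qed
      have fx: "f x > 0" using f(4)[OF x r(3)] .
      have fM: "f x \<le> M * norm x" using M(4)[OF r(4)] fx by simp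
      have "K * f x \<le> K * (M * norm x)" using fM K0 by (intro mult_left_mono)
      then have Kf: "K * f x \<le> 1" using R1x by (simp add: mult.assoc)
      have "(N\<^sup>2 / 4 + \<epsilon> * norm x powr \<epsilon> / 8) / (norm x)\<^sup>2 - 2 * ((N\<^sup>2 / 4 + 1) / R\<^sup>2) - 4 / R\<^sup>2
        \<le> divergence (G' x) - (norm (G x))\<^sup>2 / radial_weight c \<epsilon> x"
        unfolding G_def G'_def
      proof (rule hardy_pointwise[where M=M and B=B])
        show "norm x powr \<epsilon> \<le> \<epsilon> / 4" "norm x powr \<epsilon> \<le> 1" using R1x \<epsilon> by auto
        show "norm x \<le> R" by fact
      qed (use n0[OF x] R fx M f(5) r \<epsilon> Kf small fM c w[OF x] in \<open>auto simp: B_def K_def N_def\<close>)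
      then show ?thesis using C0 by (simp add: C_def N_def)
    next
      case False
      then have z: "divergence (G' x) = 0" "G x = 0"
        using cut0[of x] by (auto simp: G_def G'_def hardy_field_eq_0 hardy_field_deriv_eq_0 divergence_def)
      have "\<epsilon> * norm x powr \<epsilon> \<le> 1 * rm" using rm[OF x] \<epsilon> by (intro mult_mono) auto
      then have "(N\<^sup>2 / 4 + \<epsilon> * norm x powr \<epsilon> / 8) / (norm x)\<^sup>2 \<le> (N\<^sup>2 / 4 + rm) / R\<^sup>2"
        using rm1 False R by (intro frac_le power_mono) auto
      moreover have "divergence (G' x) - (norm (G x))\<^sup>2 / radial_weight c \<epsilon> x = 0"
        using z by simp
      ultimately show ?thesis using C0 unfolding C_def N_def by linarith
    qed
  next
    fix v
    have "continuous_on (\<Omega> \<inter> ball 0 r0) (\<lambda>x. G' x v)"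
      unfolding G'_def using n0 f(4) by (intro hardy_field_deriv_continuous f(1)) force+
    moreover have "continuous_on {x. R < norm x} (\<lambda>x. G' x v)"
      by (subst continuous_on_cong[OF refl, of _ _ "\<lambda>_. 0"])
         (auto simp: G'_def hardy_field_deriv_eq_0 cut0)
    ultimately have "continuous_on (\<Omega> \<inter> ball 0 r0 \<union> {x. R < norm x}) (\<lambda>x. G' x v)"
      using op opR by (intro continuous_on_open_Un) auto
    then show "continuous_on \<Omega> (\<lambda>x. G' x v)"
      by (rule continuous_on_subset) (use R in auto)
  qed
qed

section \<open>Passage to the limit\<close>

text \<open>Expand a around b and split the cross term by Young's inequality with a free parameter
  \<open>s\<close>.\<close>

lemma square_norm_diff_bound:
  fixes a b :: "'a::real_inner"
  assumes "s > 0"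
  shows "\<bar>(norm a)\<^sup>2 - (norm b)\<^sup>2\<bar> \<le> (1 + 1 / s) * (norm (a - b))\<^sup>2 + s * (norm b)\<^sup>2"
proof -
  have "(norm a)\<^sup>2 - (norm b)\<^sup>2 = (norm (a - b))\<^sup>2 + 2 * (b \<bullet> (a - b))"
    unfolding power2_norm_eq_inner by (simp add: inner_diff_left inner_diff_right inner_commute)
  moreover have "2 * \<bar>b \<bullet> (a - b)\<bar> \<le> s * (norm b)\<^sup>2 + (1 / s) * (norm (a - b))\<^sup>2"
  proof -
    have "\<bar>b \<bullet> (a - b)\<bar> \<le> norm b * norm (a - b)" by (rule Cauchy_Schwarz_ineq2)
    moreover have "2 * (norm b * norm (a - b)) \<le> s * (norm b)\<^sup>2 + (1 / s) * (norm (a - b))\<^sup>2"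
    proof -
      have "0 \<le> (s * norm b - norm (a - b))\<^sup>2 / s" using assms by simp
      also have "\<dots> = s * (norm b)\<^sup>2 + (1 / s) * (norm (a - b))\<^sup>2 - 2 * (norm b * norm (a - b))"
        using assms by (simp add: power2_eq_square field_simps)
      finally show ?thesis by simp
    qed
    ultimately show ?thesis by linarith
  qed
  moreover have "(1 + 1 / s) * (norm (a - b))\<^sup>2 = (norm (a - b))\<^sup>2 + (1 / s) * (norm (a - b))\<^sup>2"
    by (simp add: distrib_right)
  moreover have "(norm (a - b))\<^sup>2 \<ge> 0" by simp
  ultimately show ?thesis by linarith
qed

lemma integrable_square_norm_diff:
  fixes f g :: "'a \<Rightarrow> 'b::euclidean_space"
  assumes "f \<in> borel_measurable M" "g \<in> borel_measurable M"
    "integrable M (\<lambda>x. (norm (f x))\<^sup>2)" "integrable M (\<lambda>x. (norm (g x))\<^sup>2)"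
  shows "integrable M (\<lambda>x. (norm (f x - g x))\<^sup>2)"
proof (rule Bochner_Integration.integrable_bound)
  show "integrable M (\<lambda>x. 2 * (norm (f x))\<^sup>2 + 2 * (norm (g x))\<^sup>2)"
    using assms by simp
  show "(\<lambda>x. (norm (f x - g x))\<^sup>2) \<in> borel_measurable M" using assms by measurable
  have "norm ((norm (f x - g x))\<^sup>2) \<le> norm (2 * (norm (f x))\<^sup>2 + 2 * (norm (g x))\<^sup>2)" for x
  proof -
    have "(norm (f x - g x))\<^sup>2 \<le> (norm (f x) + norm (g x))\<^sup>2"
      by (intro power_mono norm_triangle_ineq4) auto
    also have "\<dots> \<le> 2 * (norm (f x))\<^sup>2 + 2 * (norm (g x))\<^sup>2"
      using sum_squares_bound[of "norm (f x)" "norm (g x)"] by (simp add: power2_sum)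
    finally show ?thesis by simp
  qed
  then show "AE x in M. norm ((norm (f x - g x))\<^sup>2) \<le> norm (2 * (norm (f x))\<^sup>2 + 2 * (norm (g x))\<^sup>2)"
    by simp
qed

lemma integrable_bounded_mult:
  fixes f :: "'a \<Rightarrow> real"
  assumes "integrable M f" "m \<in> borel_measurable M" "\<And>x. x \<in> space M \<Longrightarrow> \<bar>m x\<bar> \<le> B"
  shows "integrable M (\<lambda>x. m x * f x)"
proof (rule Bochner_Integration.integrable_bound)
  show "integrable M (\<lambda>x. B * f x)" using assms by simp
  show "(\<lambda>x. m x * f x) \<in> borel_measurable M"
    using assms by (intro borel_measurable_times) auto
  have "norm (m x * f x) \<le> norm (B * f x)" if "x \<in> space M" for x
    using mult_right_mono[of "\<bar>m x\<bar>" "\<bar>B\<bar>" "\<bar>f x\<bar>"] assms(3)[OF that] by (simp add: abs_mult)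
  then show "AE x in M. norm (m x * f x) \<le> norm (B * f x)" by (rule AE_I2)
qed

lemma tendsto_weighted_square_integral:
  fixes F :: "nat \<Rightarrow> 'a \<Rightarrow> 'b::euclidean_space" and m :: "'a \<Rightarrow> real"
  assumes m: "m \<in> borel_measurable M" "\<And>x. x \<in> space M \<Longrightarrow> \<bar>m x\<bar> \<le> B"
    and F: "\<And>n. F n \<in> borel_measurable M" "\<And>n. integrable M (\<lambda>x. (norm (F n x))\<^sup>2)"
    and f: "f \<in> borel_measurable M" "integrable M (\<lambda>x. (norm (f x))\<^sup>2)"
    and lim: "(\<lambda>n. LINT x|M. (norm (F n x - f x))\<^sup>2) \<longlonglongrightarrow> 0"
  shows "(\<lambda>n. LINT x|M. m x * (norm (F n x))\<^sup>2) \<longlonglongrightarrow> (LINT x|M. m x * (norm (f x))\<^sup>2)"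
proof -
  define e where "e = (\<lambda>n. LINT x|M. (norm (F n x - f x))\<^sup>2)"
  define I where "I = (LINT x|M. (norm (f x))\<^sup>2)"
  \<comment> \<open>The parameter has to tend to 0 while e / s tends to 0 too; sqrt e does both, and
    the second summand keeps \<open>s\<close> positive when e = 0.\<close>
  define s where "s = (\<lambda>n. sqrt (e n) + inverse (real (Suc n)))"
  have e0: "e n \<ge> 0" for n by (simp add: e_def)
  have s0: "s n > 0" for n
    unfolding s_def using e0[of n] by (intro add_nonneg_pos) auto
  have di: "integrable M (\<lambda>x. (norm (F n x - f x))\<^sup>2)" for n
    by (rule integrable_square_norm_diff) (use F f in auto)
  have mi: "integrable M (\<lambda>x. m x * (norm (F n x))\<^sup>2)" "integrable M (\<lambda>x. m x * (norm (f x))\<^sup>2)" for n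
    using integrable_bounded_mult[OF F(2) m] integrable_bounded_mult[OF f(2) m] by auto
  have "(\<lambda>n. (LINT x|M. m x * (norm (F n x))\<^sup>2) - (LINT x|M. m x * (norm (f x))\<^sup>2)) \<longlonglongrightarrow> 0"
  proof (rule Lim_null_comparison)
    show "\<forall>\<^sub>F n in sequentially. norm ((LINT x|M. m x * (norm (F n x))\<^sup>2) - (LINT x|M. m x * (norm (f x))\<^sup>2))
        \<le> \<bar>B\<bar> * (e n + sqrt (e n) + s n * I)"
    proof (intro always_eventually allI)
      fix n
      have "norm ((LINT x|M. m x * (norm (F n x))\<^sup>2) - (LINT x|M. m x * (norm (f x))\<^sup>2))
        = norm (LINT x|M. m x * (norm (F n x))\<^sup>2 - m x * (norm (f x))\<^sup>2)"
        by (subst Bochner_Integration.integral_diff[OF mi]) simp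
      also have "\<dots> \<le> (LINT x|M. norm (m x * (norm (F n x))\<^sup>2 - m x * (norm (f x))\<^sup>2))"
        by (rule integral_norm_bound)
      also have "\<dots> \<le> (LINT x|M. \<bar>B\<bar> * ((1 + 1 / s n) * (norm (F n x - f x))\<^sup>2 + s n * (norm (f x))\<^sup>2))"
      proof (rule integral_mono)
        show "integrable M (\<lambda>x. norm (m x * (norm (F n x))\<^sup>2 - m x * (norm (f x))\<^sup>2))"
          using mi by auto
        show "integrable M (\<lambda>x. \<bar>B\<bar> * ((1 + 1 / s n) * (norm (F n x - f x))\<^sup>2 + s n * (norm (f x))\<^sup>2))"
          using di f by auto
        fix x assume x: "x \<in> space M"
        have "norm (m x * (norm (F n x))\<^sup>2 - m x * (norm (f x))\<^sup>2)
            = \<bar>m x\<bar> * \<bar>(norm (F n x))\<^sup>2 - (norm (f x))\<^sup>2\<bar>"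
          by (simp add: abs_mult[symmetric] right_diff_distrib)
        also have "\<dots> \<le> \<bar>B\<bar> * ((1 + 1 / s n) * (norm (F n x - f x))\<^sup>2 + s n * (norm (f x))\<^sup>2)"
          using m(2)[OF x] square_norm_diff_bound[OF s0[of n], of "F n x" "f x"]
          by (intro mult_mono) auto
        finally show "norm (m x * (norm (F n x))\<^sup>2 - m x * (norm (f x))\<^sup>2)
          \<le> \<bar>B\<bar> * ((1 + 1 / s n) * (norm (F n x - f x))\<^sup>2 + s n * (norm (f x))\<^sup>2)" .
      qed
      also have "\<dots> = \<bar>B\<bar> * ((1 + 1 / s n) * e n + s n * I)"
        using di[of n] f(2) by (simp add: e_def I_def)
      also have "\<dots> \<le> \<bar>B\<bar> * (e n + sqrt (e n) + s n * I)"
      proof -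
        have "e n = sqrt (e n) * sqrt (e n)" using e0[of n] by simp
        also have "\<dots> \<le> sqrt (e n) * s n"
          using e0[of n] by (intro mult_left_mono) (auto simp: s_def)
        finally have "e n / s n \<le> sqrt (e n)" using s0[of n] by (simp add: pos_divide_le_eq)
        then show ?thesis by (intro mult_left_mono) (auto simp: distrib_right)
      qed
      finally show "norm ((LINT x|M. m x * (norm (F n x))\<^sup>2) - (LINT x|M. m x * (norm (f x))\<^sup>2))
        \<le> \<bar>B\<bar> * (e n + sqrt (e n) + s n * I)" .
    qed
    have l: "e \<longlonglongrightarrow> 0" using lim by (simp add: e_def)
    have "(\<lambda>n. sqrt (e n)) \<longlonglongrightarrow> sqrt 0" by (intro tendsto_real_sqrt l)
    then have l2: "(\<lambda>n. sqrt (e n)) \<longlonglongrightarrow> 0" by simp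
    have "s \<longlonglongrightarrow> 0 + 0" unfolding s_def by (intro tendsto_add l2 LIMSEQ_inverse_real_of_nat)
    then have "(\<lambda>n. \<bar>B\<bar> * (e n + sqrt (e n) + s n * I)) \<longlonglongrightarrow> \<bar>B\<bar> * (0 + 0 + (0 + 0) * I)"
      by (intro tendsto_intros l l2)
    then show "(\<lambda>n. \<bar>B\<bar> * (e n + sqrt (e n) + s n * I)) \<longlonglongrightarrow> 0" by simp
  qed
  then show ?thesis by (rule LIM_zero_cancel)
qed

section \<open>From test functions to the closure\<close>

text \<open>Inequalities for test functions are proved over the whole space with Borel measure,
  whereas the Sobolev spaces use Lebesgue measure on \<Omega>; this translates between them.\<close>

lemma lebesgue_on_lborel:
  fixes f :: "'a::euclidean_space \<Rightarrow> real"
  assumes "f \<in> borel_measurable borel" "\<And>x. x \<notin> \<Omega> \<Longrightarrow> f x = 0" "\<Omega> \<in> sets lebesgue"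
  shows "integrable (lebesgue_on \<Omega>) f \<longleftrightarrow> integrable lborel f"
    and "(LINT x|lebesgue_on \<Omega>. f x) = (LINT x|lborel. f x)"
proof -
  have eq: "(\<lambda>x. indicator \<Omega> x *\<^sub>R f x) = f"
    using assms(2) by (auto simp: fun_eq_iff indicator_def)
  have fm: "f \<in> borel_measurable lborel" using assms(1) by simp
  have "integrable (lebesgue_on \<Omega>) f \<longleftrightarrow> integrable lebesgue (\<lambda>x. indicator \<Omega> x *\<^sub>R f x)"
    by (rule integrable_restrict_space) (use assms in auto)
  then show "integrable (lebesgue_on \<Omega>) f \<longleftrightarrow> integrable lborel f"
    unfolding eq integrable_completion[OF fm] .
  have "(LINT x|lebesgue_on \<Omega>. f x) = (LINT x|lebesgue. indicator \<Omega> x *\<^sub>R f x)"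
    by (rule integral_restrict_space) (use assms in auto)
  then show "(LINT x|lebesgue_on \<Omega>. f x) = (LINT x|lborel. f x)"
    unfolding eq integral_completion[OF fm] .
qed

lemma continuous_borel_measurable_lebesgue_on:
  fixes f :: "'a::euclidean_space \<Rightarrow> 'b::euclidean_space"
  assumes "continuous_on UNIV f"
  shows "f \<in> borel_measurable (lebesgue_on \<Omega>)"
  using borel_measurable_continuous_onI[OF assms]
  by (intro measurable_restrict_space1 measurable_completion) simp

lemma test_functions_L2:
  assumes \<phi>: "\<phi> \<in> test_functions \<Omega>" and op: "open \<Omega>"
  shows "\<phi> \<in> L2 \<Omega>" "gradient \<phi> \<in> L2 \<Omega>"
proof -
  note sm = test_functions_smooth[OF \<phi>]
  note su = test_functions_supp[OF \<phi>]
  have m: "\<Omega> \<in> sets lebesgue" using op by simp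
  have *: "integrable (lebesgue_on \<Omega>) f" if f: "continuous_on UNIV f" "\<And>x. x \<notin> supp \<phi> \<Longrightarrow> f x = 0"
    for f :: "'a \<Rightarrow> real"
  proof (subst lebesgue_on_lborel(1))
    show "f \<in> borel_measurable borel" using f(1) by (rule borel_measurable_continuous_onI)
    show "integrable lborel f"
      by (rule integrable_lborel_continuous_compact[OF f(1) su(1) f(2)])
  qed (use su(2) f(2) m in auto)
  have "integrable (lebesgue_on \<Omega>) (\<lambda>x. (norm (\<phi> x))\<^sup>2)"
    by (rule *) (auto intro!: continuous_intros smooth_continuous[OF sm] simp: su(3))
  then show "\<phi> \<in> L2 \<Omega>"
    by (simp add: L2_def continuous_borel_measurable_lebesgue_on[OF smooth_continuous[OF sm]])
  have "integrable (lebesgue_on \<Omega>) (\<lambda>x. (norm (gradient \<phi> x))\<^sup>2)"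
    by (rule *) (auto intro!: continuous_intros smooth_continuous_gradient[OF sm]
        simp: gradient_outside_supp[OF sm])
  then show "gradient \<phi> \<in> L2 \<Omega>"
    by (simp add: L2_def continuous_borel_measurable_lebesgue_on[OF smooth_continuous_gradient[OF sm]])
qed

text \<open>The potential is truncated, since the convergence in \<open>L\<^sup>2\<close> gives no control of
  unbounded weights.\<close>

lemma quadratic_form_inequality_limit:
  fixes u :: "'a::euclidean_space \<Rightarrow> real" and g :: "'a \<Rightarrow> 'a" and w V :: "'a \<Rightarrow> real"
  assumes op: "open \<Omega>" and u: "u \<in> L2 \<Omega>" and g: "g \<in> L2 \<Omega>"
    and \<phi>: "\<And>n. \<phi> n \<in> test_functions \<Omega>"
    and lim: "(\<lambda>n. LINT x|lebesgue_on \<Omega>. (\<phi> n x - u x)\<^sup>2 + (norm (gradient (\<phi> n) x - g x))\<^sup>2) \<longlonglongrightarrow> 0"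
    and w: "w \<in> borel_measurable (lebesgue_on \<Omega>)" "\<And>x. x \<in> \<Omega> \<Longrightarrow> \<bar>w x\<bar> \<le> B"
    and V: "V \<in> borel_measurable (lebesgue_on \<Omega>)" "\<And>x. x \<in> \<Omega> \<Longrightarrow> V x \<ge> 0"
    and int: "\<And>\<psi>. \<psi> \<in> test_functions \<Omega> \<Longrightarrow>
      integrable lborel (\<lambda>x. w x * (norm (gradient \<psi> x))\<^sup>2 - (V x - C) * (\<psi> x)\<^sup>2)"
    and ge: "\<And>\<psi>. \<psi> \<in> test_functions \<Omega> \<Longrightarrow>
      (LINT x|lborel. w x * (norm (gradient \<psi> x))\<^sup>2 - (V x - C) * (\<psi> x)\<^sup>2) \<ge> 0"
  shows "integrable (lebesgue_on \<Omega>) (\<lambda>x. V x * (u x)\<^sup>2)"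
    and "(LINT x|lebesgue_on \<Omega>. V x * (u x)\<^sup>2)
      \<le> C * (LINT x|lebesgue_on \<Omega>. (u x)\<^sup>2) + (LINT x|lebesgue_on \<Omega>. w x * (norm (g x))\<^sup>2)"
proof -
  define M where "M = lebesgue_on \<Omega>"
  have sp: "space M = \<Omega>" by (simp add: M_def)
  have mO: "\<Omega> \<in> sets lebesgue" using op by simp
  have uL: "u \<in> borel_measurable M" "integrable M (\<lambda>x. (norm (u x))\<^sup>2)"
    and gL: "g \<in> borel_measurable M" "integrable M (\<lambda>x. (norm (g x))\<^sup>2)"
    using u g by (auto simp: L2_def M_def)
  have pL: "\<phi> n \<in> borel_measurable M" "integrable M (\<lambda>x. (norm (\<phi> n x))\<^sup>2)"
    and qL: "gradient (\<phi> n) \<in> borel_measurable M" "integrable M (\<lambda>x. (norm (gradient (\<phi> n) x))\<^sup>2)" for n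
    using test_functions_L2[OF \<phi> op] by (auto simp: L2_def M_def)
  have d1: "integrable M (\<lambda>x. (norm (\<phi> n x - u x))\<^sup>2)"
    and d2: "integrable M (\<lambda>x. (norm (gradient (\<phi> n) x - g x))\<^sup>2)" for n
    using integrable_square_norm_diff[OF pL(1) uL(1) pL(2) uL(2)]
      integrable_square_norm_diff[OF qL(1) gL(1) qL(2) gL(2)] by auto
  have lim': "(\<lambda>n. LINT x|M. (norm (\<phi> n x - u x))\<^sup>2 + (norm (gradient (\<phi> n) x - g x))\<^sup>2) \<longlonglongrightarrow> 0"
    using lim by (simp add: M_def)
  have l1: "(\<lambda>n. LINT x|M. (norm (\<phi> n x - u x))\<^sup>2) \<longlonglongrightarrow> 0"
    by (rule Lim_null_comparison[OF always_eventually lim'])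
       (use d1 d2 in \<open>auto intro!: integral_mono\<close>)
  have l2: "(\<lambda>n. LINT x|M. (norm (gradient (\<phi> n) x - g x))\<^sup>2) \<longlonglongrightarrow> 0"
    by (rule Lim_null_comparison[OF always_eventually lim'])
       (use d1 d2 in \<open>auto intro!: integral_mono\<close>)
  define W where "W = (\<lambda>(k::nat) x. min (V x) (real k))"
  have Wm: "W k \<in> borel_measurable M" for k
    unfolding W_def using V(1) by (auto simp: M_def)
  have Wb: "\<bar>W k x\<bar> \<le> real k" "W k x \<le> V x" "0 \<le> W k x" if "x \<in> space M" for k x
    using V(2)[of x] that by (auto simp: W_def sp)
  have wM: "w \<in> borel_measurable M" "\<And>x. x \<in> space M \<Longrightarrow> \<bar>w x\<bar> \<le> B"
    using w by (auto simp: M_def)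
  define L where "L = C * (LINT x|M. (u x)\<^sup>2) + (LINT x|M. w x * (norm (g x))\<^sup>2)"
  have Wu: "integrable M (\<lambda>x. W k x * (u x)\<^sup>2)" for k
    using integrable_bounded_mult[OF uL(2) Wm Wb(1)] by simp
  have WL: "(LINT x|M. W k x * (u x)\<^sup>2) \<le> L" for k
  proof (rule LIMSEQ_le)
    show "(\<lambda>n. LINT x|M. W k x * (\<phi> n x)\<^sup>2) \<longlonglongrightarrow> (LINT x|M. W k x * (u x)\<^sup>2)"
      using tendsto_weighted_square_integral[OF Wm Wb(1) pL uL l1, of k] by simp
    have "(\<lambda>n. LINT x|M. 1 * (norm (\<phi> n x))\<^sup>2) \<longlonglongrightarrow> (LINT x|M. 1 * (norm (u x))\<^sup>2)"
      by (rule tendsto_weighted_square_integral[OF _ _ pL uL l1, of _ 1]) auto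
    then have "(\<lambda>n. LINT x|M. (\<phi> n x)\<^sup>2) \<longlonglongrightarrow> (LINT x|M. (u x)\<^sup>2)" by simp
    then show "(\<lambda>n. C * (LINT x|M. (\<phi> n x)\<^sup>2) + (LINT x|M. w x * (norm (gradient (\<phi> n) x))\<^sup>2)) \<longlonglongrightarrow> L"
      unfolding L_def
      by (intro tendsto_add tendsto_mult tendsto_const
          tendsto_weighted_square_integral[OF wM qL gL l2])
    show "\<exists>N. \<forall>n\<ge>N. (LINT x|M. W k x * (\<phi> n x)\<^sup>2)
        \<le> C * (LINT x|M. (\<phi> n x)\<^sup>2) + (LINT x|M. w x * (norm (gradient (\<phi> n) x))\<^sup>2)"
    proof (intro exI allI impI)
      fix n :: nat
      let ?h = "\<lambda>x. w x * (norm (gradient (\<phi> n) x))\<^sup>2 - (V x - C) * (\<phi> n x)\<^sup>2"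
      have z: "?h x = 0" if "x \<notin> \<Omega>" for x
      proof -
        have "x \<notin> supp (\<phi> n)" using that test_functions_supp(2)[OF \<phi>] by blast
        then show ?thesis
          using test_functions_supp(3)[OF \<phi>] gradient_outside_supp[OF test_functions_smooth[OF \<phi>]]
          by simp
      qed
      \<comment> \<open>\<open>w\<close> and \<open>V\<close> are assumed measurable only on
        \<Omega> and in the Lebesgue sense; the Borel measurability of the combination is read off
        from its integrability.\<close>
      have bm: "?h \<in> borel_measurable borel"
        using borel_measurable_integrable[OF int[OF \<phi>]] by simp
      have hi: "integrable M ?h" and h0: "(LINT x|M. ?h x) \<ge> 0"
        using lebesgue_on_lborel[OF bm z mO] int[OF \<phi>] ge[OF \<phi>] unfolding M_def by auto
      have pi: "integrable M (\<lambda>x. (\<phi> n x)\<^sup>2)" using pL(2)[of n] by simp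
      have gi: "integrable M (\<lambda>x. w x * (norm (gradient (\<phi> n) x))\<^sup>2)"
        by (rule integrable_bounded_mult[OF qL(2) wM])
      have wi: "integrable M (\<lambda>x. W k x * (\<phi> n x)\<^sup>2)"
        by (rule integrable_bounded_mult[OF pi Wm Wb(1)])
      have "0 \<le> (LINT x|M. ?h x)" by (rule h0)
      also have "\<dots> \<le> (LINT x|M. (C * (\<phi> n x)\<^sup>2 + w x * (norm (gradient (\<phi> n) x))\<^sup>2) - W k x * (\<phi> n x)\<^sup>2)"
      proof (rule integral_mono[OF hi])
        show "integrable M (\<lambda>x. (C * (\<phi> n x)\<^sup>2 + w x * (norm (gradient (\<phi> n) x))\<^sup>2) - W k x * (\<phi> n x)\<^sup>2)"
          using pi gi wi by auto
        fix x assume "x \<in> space M"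
        then have "W k x * (\<phi> n x)\<^sup>2 \<le> V x * (\<phi> n x)\<^sup>2"
          by (intro mult_right_mono Wb) auto
        then show "?h x \<le> (C * (\<phi> n x)\<^sup>2 + w x * (norm (gradient (\<phi> n) x))\<^sup>2) - W k x * (\<phi> n x)\<^sup>2"
          by (simp add: left_diff_distrib)
      qed
      also have "\<dots> = C * (LINT x|M. (\<phi> n x)\<^sup>2) + (LINT x|M. w x * (norm (gradient (\<phi> n) x))\<^sup>2)
          - (LINT x|M. W k x * (\<phi> n x)\<^sup>2)"
        using pi gi wi by simp
      finally show "(LINT x|M. W k x * (\<phi> n x)\<^sup>2)
        \<le> C * (LINT x|M. (\<phi> n x)\<^sup>2) + (LINT x|M. w x * (norm (gradient (\<phi> n) x))\<^sup>2)" by simp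
    qed
  qed
  \<comment> \<open>The limit in n was taken for fixed k, with the bound \<open>L\<close>
    independent of k. Monotone convergence in k now yields integrability of V u^2 together with the
    inequality.\<close>
  have inc: "incseq (\<lambda>k. LINT x|M. W k x * (u x)\<^sup>2)"
  proof (rule incseq_SucI, rule integral_mono[OF Wu Wu])
    show "W k x * (u x)\<^sup>2 \<le> W (Suc k) x * (u x)\<^sup>2" for k x
      by (intro mult_right_mono) (auto simp: W_def)
  qed
  obtain l where l: "(\<lambda>k. LINT x|M. W k x * (u x)\<^sup>2) \<longlonglongrightarrow> l"
    using incseq_convergent[OF inc] WL by blast
  have "l \<le> L" by (rule LIMSEQ_le_const2[OF l]) (use WL in auto)
  have pos: "AE x in M. 0 \<le> W k x * (u x)\<^sup>2" for k
    using Wb(3) by (intro AE_I2 mult_nonneg_nonneg) auto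
  have mono: "AE x in M. mono (\<lambda>k. W k x * (u x)\<^sup>2)"
    by (intro AE_I2 monoI mult_right_mono) (auto simp: W_def)
  have ptw: "AE x in M. (\<lambda>k. W k x * (u x)\<^sup>2) \<longlonglongrightarrow> V x * (u x)\<^sup>2"
  proof (intro AE_I2 tendsto_mult tendsto_const)
    fix x
    obtain K :: nat where K: "V x \<le> real K" using real_arch_simple by blast
    have "\<forall>\<^sub>F k in sequentially. W k x = V x"
      using eventually_ge_at_top[of K] by eventually_elim (use K in \<open>auto simp: W_def min_def\<close>)
    then show "(\<lambda>k. W k x) \<longlonglongrightarrow> V x" by (rule tendsto_eventually)
  qed
  have "(\<lambda>x. V x * (u x)\<^sup>2) \<in> borel_measurable M"
    using V(1) uL(1) unfolding M_def by measurable
  note mc = integral_monotone_convergence_nonneg[OF Wu mono pos ptw l this]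
  show "integrable (lebesgue_on \<Omega>) (\<lambda>x. V x * (u x)\<^sup>2)" using mc(1) by (simp add: M_def)
  show "(LINT x|lebesgue_on \<Omega>. V x * (u x)\<^sup>2)
      \<le> C * (LINT x|lebesgue_on \<Omega>. (u x)\<^sup>2) + (LINT x|lebesgue_on \<Omega>. w x * (norm (g x))\<^sup>2)"
    using mc(2) \<open>l \<le> L\<close> by (simp add: M_def L_def)
qed

text \<open>\<open>H10\<close> only asserts convergence to some weak gradient. By uniqueness any
  other one agrees with it almost everywhere, hence is in \<open>L2\<close> and is the limit of the
  same sequence.\<close>

lemma H10_approximation:
  fixes \<Omega> :: "'a::euclidean_space set"
  assumes op: "open \<Omega>" and u: "u \<in> H10 \<Omega>" and g: "has_weak_gradient \<Omega> u g"
  obtains \<phi> where "\<And>n. \<phi> n \<in> test_functions \<Omega>" "u \<in> L2 \<Omega>" "g \<in> L2 \<Omega>"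
    "(\<lambda>n. LINT x|lebesgue_on \<Omega>. (\<phi> n x - u x)\<^sup>2 + (norm (gradient (\<phi> n) x - g x))\<^sup>2) \<longlonglongrightarrow> 0"
proof -
  obtain h \<phi> where h: "h \<in> L2 \<Omega>" "has_weak_gradient \<Omega> u h" and \<phi>: "\<And>n. \<phi> n \<in> test_functions \<Omega>"
    and lim: "(\<lambda>n. LINT x|lebesgue_on \<Omega>. (\<phi> n x - u x)\<^sup>2 + (norm (gradient (\<phi> n) x - h x))\<^sup>2) \<longlonglongrightarrow> 0"
    and uL: "u \<in> L2 \<Omega>"
    using u by (auto simp: H10_def H1_def)
  have mO: "\<Omega> \<in> sets lebesgue" using op by simp
  have "negligible {x \<in> \<Omega>. h x \<noteq> g x}" by (rule weak_gradient_unique[OF op h(2) g])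
  then have "{x \<in> \<Omega>. h x \<noteq> g x} \<in> null_sets lebesgue" by (simp add: negligible_iff_null_sets)
  then have ae0: "AE x in lebesgue. x \<in> \<Omega> \<longrightarrow> h x = g x"
    by (auto simp: AE_iff_null_sets dest!: AE_not_in elim!: eventually_mono)
  then have ae: "AE x in lebesgue_on \<Omega>. h x = g x"
    using mO by (subst AE_restrict_space_iff) auto
  have hm: "h \<in> borel_measurable (lebesgue_on \<Omega>)" using h by (simp add: L2_def)
  \<comment> \<open>Completeness of Lebesgue measure transfers measurability along almost-everywhere
    equality.\<close>
  have "(\<lambda>x. if x \<in> \<Omega> then g x else 0) \<in> borel_measurable lebesgue"
  proof (rule borel_measurable_AE)
    show "(\<lambda>x. if x \<in> \<Omega> then h x else 0) \<in> borel_measurable lebesgue"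
      using hm mO by (simp add: borel_measurable_if)
    show "AE x in lebesgue. (if x \<in> \<Omega> then h x else 0) = (if x \<in> \<Omega> then g x else 0)"
      using ae0 by eventually_elim auto
  qed
  then have gm: "g \<in> borel_measurable (lebesgue_on \<Omega>)"
    using mO by (simp add: borel_measurable_if)
  have "integrable (lebesgue_on \<Omega>) (\<lambda>x. (norm (g x))\<^sup>2)"
  proof (rule integrable_cong_AE_imp)
    show "integrable (lebesgue_on \<Omega>) (\<lambda>x. (norm (h x))\<^sup>2)" using h by (simp add: L2_def)
    show "AE x in lebesgue_on \<Omega>. (norm (h x))\<^sup>2 = (norm (g x))\<^sup>2"
      using ae by eventually_elim simp
  qed (use gm in measurable)
  then have gL: "g \<in> L2 \<Omega>" using gm by (simp add: L2_def)
  have eq: "(LINT x|lebesgue_on \<Omega>. (\<phi> n x - u x)\<^sup>2 + (norm (gradient (\<phi> n) x - h x))\<^sup>2)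
      = (LINT x|lebesgue_on \<Omega>. (\<phi> n x - u x)\<^sup>2 + (norm (gradient (\<phi> n) x - g x))\<^sup>2)" for n
  proof (rule integral_cong_AE)
    have m: "\<phi> n \<in> borel_measurable (lebesgue_on \<Omega>)" "gradient (\<phi> n) \<in> borel_measurable (lebesgue_on \<Omega>)"
      "u \<in> borel_measurable (lebesgue_on \<Omega>)"
      using test_functions_L2[OF \<phi>[of n] op] uL by (auto simp: L2_def)
    show "(\<lambda>x. (\<phi> n x - u x)\<^sup>2 + (norm (gradient (\<phi> n) x - h x))\<^sup>2) \<in> borel_measurable (lebesgue_on \<Omega>)"
      using m hm by measurable
    show "(\<lambda>x. (\<phi> n x - u x)\<^sup>2 + (norm (gradient (\<phi> n) x - g x))\<^sup>2) \<in> borel_measurable (lebesgue_on \<Omega>)"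
      using m gm by measurable
    show "AE x in lebesgue_on \<Omega>. (\<phi> n x - u x)\<^sup>2 + (norm (gradient (\<phi> n) x - h x))\<^sup>2
        = (\<phi> n x - u x)\<^sup>2 + (norm (gradient (\<phi> n) x - g x))\<^sup>2"
      using ae by eventually_elim simp
  qed
  show ?thesis
    by (rule that[OF \<phi> uL gL]) (use lim in \<open>simp add: eq\<close>)
qed

text \<open>The part c |x| powr \<epsilon> missing from the weight moves to the left side and
  becomes the gradient term. The constant N^2/4 is kept exactly, with the two extra terms as
  surplus.\<close>

lemma hardy_inequality_H10:
  fixes \<Omega> :: "'a::euclidean_space set"
  assumes op: "open \<Omega>" and bd: "bounded \<Omega>" and sb: "smooth_boundary \<Omega>" and fr: "0 \<in> frontier \<Omega>"
    and \<epsilon>: "0 < \<epsilon>" "\<epsilon> < 1"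
  obtains c C where "c > 0" "C > 0"
    "\<And>u g. u \<in> H10 \<Omega> \<Longrightarrow> has_weak_gradient \<Omega> u g \<Longrightarrow>
      u \<in> L2 \<Omega> \<and> g \<in> L2 \<Omega> \<and>
      integrable (lebesgue_on \<Omega>) (\<lambda>x. norm x powr \<epsilon> * (norm (g x))\<^sup>2) \<and>
      integrable (lebesgue_on \<Omega>) (\<lambda>x. (u x)\<^sup>2 / (norm x)\<^sup>2) \<and>
      integrable (lebesgue_on \<Omega>) (\<lambda>x. norm x powr \<epsilon> * ((u x)\<^sup>2 / (norm x)\<^sup>2)) \<and>
      (real DIM('a))\<^sup>2 / 4 * (LINT x|lebesgue_on \<Omega>. (u x)\<^sup>2 / (norm x)\<^sup>2)
        + \<epsilon> / 8 * (LINT x|lebesgue_on \<Omega>. norm x powr \<epsilon> * ((u x)\<^sup>2 / (norm x)\<^sup>2))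
        + c * (LINT x|lebesgue_on \<Omega>. norm x powr \<epsilon> * (norm (g x))\<^sup>2)
      \<le> C * (LINT x|lebesgue_on \<Omega>. (u x)\<^sup>2) + (LINT x|lebesgue_on \<Omega>. (norm (g x))\<^sup>2)"
proof -
  define N where "N = real DIM('a)"
  have N: "N > 0" by (simp add: N_def)
  obtain c C and G :: "'a \<Rightarrow> 'a" and G' where cC: "c > 0" "C > 0"
    and G: "\<And>x. x \<in> \<Omega> \<Longrightarrow> (G has_derivative G' x) (at x)"
    and cG: "\<And>v. continuous_on \<Omega> (\<lambda>x. G' x v)"
    and w: "\<And>x. x \<in> \<Omega> \<Longrightarrow> radial_weight c \<epsilon> x \<ge> 1 / 2"
    and le: "\<And>x. x \<in> \<Omega> \<Longrightarrow> (N\<^sup>2 / 4 + \<epsilon> * norm x powr \<epsilon> / 8) / (norm x)\<^sup>2 - C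
      \<le> divergence (G' x) - (norm (G x))\<^sup>2 / radial_weight c \<epsilon> x"
    using hardy_field_exists[OF op bd sb fr \<epsilon>] unfolding N_def by metis
  have "0 \<notin> \<Omega>" using fr op by (simp add: frontier_def interior_open)
  then have n0: "x \<noteq> 0" if "x \<in> \<Omega>" for x using that by blast
  have mO: "\<Omega> \<in> sets lebesgue" using op by simp
  define V where "V = (\<lambda>x::'a. (N\<^sup>2 / 4 + \<epsilon> * norm x powr \<epsilon> / 8) / (norm x)\<^sup>2)"
  have powc: "continuous_on \<Omega> (\<lambda>x. norm x powr e)" for e
    using n0 by (intro continuous_intros) auto
  have Vc: "continuous_on \<Omega> V"
    unfolding V_def using n0 by (intro continuous_intros powc) auto
  have wc: "continuous_on \<Omega> (radial_weight c \<epsilon>)"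
    unfolding radial_weight_def[abs_def] by (intro continuous_intros powc)
  note meas = continuous_imp_measurable_on_sets_lebesgue[OF _ mO]
  have rho_le: "norm x powr \<epsilon> \<le> 1 / (2 * c)" if "x \<in> \<Omega>" for x
    using w[OF that] cC(1) by (simp add: radial_weight_def field_simps)
  show ?thesis
  proof (rule that[OF cC])
    fix u g assume u: "u \<in> H10 \<Omega>" and g: "has_weak_gradient \<Omega> u g"
    obtain \<phi> where \<phi>: "\<And>n. \<phi> n \<in> test_functions \<Omega>" and uL: "u \<in> L2 \<Omega>" and gL: "g \<in> L2 \<Omega>"
      and lim: "(\<lambda>n. LINT x|lebesgue_on \<Omega>. (\<phi> n x - u x)\<^sup>2 + (norm (gradient (\<phi> n) x - g x))\<^sup>2) \<longlonglongrightarrow> 0"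
      using H10_approximation[OF op u g] by blast
    have test: "integrable lborel (\<lambda>x. radial_weight c \<epsilon> x * (norm (gradient \<psi> x))\<^sup>2 - (V x - C) * (\<psi> x)\<^sup>2)"
      "(LINT x|lborel. radial_weight c \<epsilon> x * (norm (gradient \<psi> x))\<^sup>2 - (V x - C) * (\<psi> x)\<^sup>2) \<ge> 0"
      if \<psi>: "\<psi> \<in> test_functions \<Omega>" for \<psi>
    proof -
      have p: "radial_weight c \<epsilon> x > 0" if "x \<in> \<Omega>" for x using w[OF that] by linarith
      have q: "V x - C \<le> divergence (G' x) - (norm (G x))\<^sup>2 / radial_weight c \<epsilon> x" if "x \<in> \<Omega>" for x
        using le[OF that] by (simp add: V_def)
      have "continuous_on \<Omega> (\<lambda>x. V x - C)" by (intro continuous_intros Vc)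
      from vector_field_inequality[OF \<psi> op G cG wc p this q]
      show "integrable lborel (\<lambda>x. radial_weight c \<epsilon> x * (norm (gradient \<psi> x))\<^sup>2 - (V x - C) * (\<psi> x)\<^sup>2)"
      "(LINT x|lborel. radial_weight c \<epsilon> x * (norm (gradient \<psi> x))\<^sup>2 - (V x - C) * (\<psi> x)\<^sup>2) \<ge> 0"
        by auto
    qed
    have wb: "\<bar>radial_weight c \<epsilon> x\<bar> \<le> 1" if "x \<in> \<Omega>" for x
      using w[OF that] cC(1) by (simp add: radial_weight_def)
    have V0: "V x \<ge> 0" if "x \<in> \<Omega>" for x
      using \<epsilon> by (simp add: V_def)
    note L = quadratic_form_inequality_limit[OF op uL gL \<phi> lim meas[OF wc] wb meas[OF Vc] V0 test]
    have um: "u \<in> borel_measurable (lebesgue_on \<Omega>)" and gm: "g \<in> borel_measurable (lebesgue_on \<Omega>)"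
      and u2: "integrable (lebesgue_on \<Omega>) (\<lambda>x. (u x)\<^sup>2)"
      and g2: "integrable (lebesgue_on \<Omega>) (\<lambda>x. (norm (g x))\<^sup>2)"
      using uL gL by (auto simp: L2_def)
    have i1: "integrable (lebesgue_on \<Omega>) (\<lambda>x. norm x powr \<epsilon> * (norm (g x))\<^sup>2)"
      by (rule integrable_bounded_mult[OF g2 meas[OF powc], of _ "1 / (2 * c)"]) (use rho_le in auto)
    have ic: "continuous_on \<Omega> (\<lambda>x. 1 / (norm x)\<^sup>2)"
      using n0 by (intro continuous_intros) auto
    have m2: "(\<lambda>x. (u x)\<^sup>2 / (norm x)\<^sup>2) \<in> borel_measurable (lebesgue_on \<Omega>)"
      using borel_measurable_times[OF meas[OF ic] borel_measurable_power[OF um, of 2]] by simp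
    have m3: "(\<lambda>x. norm x powr \<epsilon> * ((u x)\<^sup>2 / (norm x)\<^sup>2)) \<in> borel_measurable (lebesgue_on \<Omega>)"
      by (rule borel_measurable_times[OF meas[OF powc] m2])
    have Veq: "V x * (u x)\<^sup>2 = N\<^sup>2 / 4 * ((u x)\<^sup>2 / (norm x)\<^sup>2) + \<epsilon> / 8 * (norm x powr \<epsilon> * ((u x)\<^sup>2 / (norm x)\<^sup>2))" for x
      by (simp add: V_def add_divide_distrib algebra_simps)
    \<comment> \<open>As N > 0, u^2 / |x|^2 is at most (4 / N^2) V u^2, whose integrability came
      with the limit.\<close>
    have i2: "integrable (lebesgue_on \<Omega>) (\<lambda>x. (u x)\<^sup>2 / (norm x)\<^sup>2)"
    proof (rule Bochner_Integration.integrable_bound[OF integrable_mult_right[OF L(1), of "4 / N\<^sup>2"] m2])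
      have "norm ((u x)\<^sup>2 / (norm x)\<^sup>2) \<le> norm (4 / N\<^sup>2 * (V x * (u x)\<^sup>2))" for x
      proof -
        have "4 / N\<^sup>2 * (V x * (u x)\<^sup>2) = (u x)\<^sup>2 / (norm x)\<^sup>2
          + 4 / N\<^sup>2 * (\<epsilon> / 8 * (norm x powr \<epsilon> * ((u x)\<^sup>2 / (norm x)\<^sup>2)))"
          unfolding Veq using N by (simp add: distrib_left)
        moreover have "0 \<le> 4 / N\<^sup>2 * (\<epsilon> / 8 * (norm x powr \<epsilon> * ((u x)\<^sup>2 / (norm x)\<^sup>2)))"
          using \<epsilon> by simp
        moreover have "0 \<le> (u x)\<^sup>2 / (norm x)\<^sup>2" by simp
        ultimately show ?thesis unfolding real_norm_def by linarith
      qed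
      then show "AE x in lebesgue_on \<Omega>. norm ((u x)\<^sup>2 / (norm x)\<^sup>2) \<le> norm (4 / N\<^sup>2 * (V x * (u x)\<^sup>2))"
        by (intro AE_I2)
    qed
    have i3: "integrable (lebesgue_on \<Omega>) (\<lambda>x. norm x powr \<epsilon> * ((u x)\<^sup>2 / (norm x)\<^sup>2))"
      by (rule integrable_bounded_mult[OF i2 meas[OF powc], of _ "1 / (2 * c)"]) (use rho_le in auto)
    have "(LINT x|lebesgue_on \<Omega>. V x * (u x)\<^sup>2)
      = N\<^sup>2 / 4 * (LINT x|lebesgue_on \<Omega>. (u x)\<^sup>2 / (norm x)\<^sup>2)
        + \<epsilon> / 8 * (LINT x|lebesgue_on \<Omega>. norm x powr \<epsilon> * ((u x)\<^sup>2 / (norm x)\<^sup>2))"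
      unfolding Veq
      by (subst Bochner_Integration.integral_add[OF integrable_mult_right[OF i2] integrable_mult_right[OF i3]])
         (simp only: integral_mult_right_zero)
    moreover have "(LINT x|lebesgue_on \<Omega>. radial_weight c \<epsilon> x * (norm (g x))\<^sup>2)
      = (LINT x|lebesgue_on \<Omega>. (norm (g x))\<^sup>2) - c * (LINT x|lebesgue_on \<Omega>. norm x powr \<epsilon> * (norm (g x))\<^sup>2)"
    proof -
      have "radial_weight c \<epsilon> x * (norm (g x))\<^sup>2
          = (norm (g x))\<^sup>2 - c * (norm x powr \<epsilon> * (norm (g x))\<^sup>2)" for x
        by (simp add: radial_weight_def left_diff_distrib mult.assoc)
      then show ?thesis
        by (simp only: Bochner_Integration.integral_diff[OF g2 integrable_mult_right[OF i1]]
            integral_mult_right_zero)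
    qed
    ultimately show "u \<in> L2 \<Omega> \<and> g \<in> L2 \<Omega> \<and>
      integrable (lebesgue_on \<Omega>) (\<lambda>x. norm x powr \<epsilon> * (norm (g x))\<^sup>2) \<and>
      integrable (lebesgue_on \<Omega>) (\<lambda>x. (u x)\<^sup>2 / (norm x)\<^sup>2) \<and>
      integrable (lebesgue_on \<Omega>) (\<lambda>x. norm x powr \<epsilon> * ((u x)\<^sup>2 / (norm x)\<^sup>2)) \<and>
      (real DIM('a))\<^sup>2 / 4 * (LINT x|lebesgue_on \<Omega>. (u x)\<^sup>2 / (norm x)\<^sup>2)
        + \<epsilon> / 8 * (LINT x|lebesgue_on \<Omega>. norm x powr \<epsilon> * ((u x)\<^sup>2 / (norm x)\<^sup>2))
        + c * (LINT x|lebesgue_on \<Omega>. norm x powr \<epsilon> * (norm (g x))\<^sup>2)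
      \<le> C * (LINT x|lebesgue_on \<Omega>. (u x)\<^sup>2) + (LINT x|lebesgue_on \<Omega>. (norm (g x))\<^sup>2)"
      using L(2) uL gL i1 i2 i3 unfolding N_def by (intro conjI) (assumption | linarith)+
  qed
qed

text \<open>The critical \<mu> carries all the work, since the integral of u^2 / |x|^2 is
  nonnegative. What remains is to exchange the weights with exponent \<epsilon> for those with
  \<gamma>.\<close>

theorem proposition1p2:
  fixes \<Omega> :: "'a::euclidean_space set" and \<mu> \<gamma> :: real
  assumes "open \<Omega>" and "connected \<Omega>" and "bounded \<Omega>"
    and "smooth_boundary \<Omega>" and "0 \<in> frontier \<Omega>"
    and "\<mu> \<le> (real DIM('a))\<^sup>2 / 4"
    and "0 \<le> \<gamma>" and "\<gamma> < 2"
  shows "\<exists>C2>0. \<exists>C3>0. \<forall>u\<in>H10 \<Omega>. \<forall>g. has_weak_gradient \<Omega> u g \<longrightarrow>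
    integrable (lebesgue_on \<Omega>) (\<lambda>x. (norm (g x))\<^sup>2 - \<mu> * ((u x)\<^sup>2 / (norm x)\<^sup>2)) \<and>
    integrable (lebesgue_on \<Omega>)
      (\<lambda>x. norm x powr (2 - \<gamma>) * (norm (g x))\<^sup>2 + (u x)\<^sup>2 / norm x powr \<gamma>) \<and>
    C2 * (LINT x|lebesgue_on \<Omega>. (u x)\<^sup>2) +
      (LINT x|lebesgue_on \<Omega>. (norm (g x))\<^sup>2 - \<mu> * ((u x)\<^sup>2 / (norm x)\<^sup>2))
    \<ge> C3 * (LINT x|lebesgue_on \<Omega>.
        norm x powr (2 - \<gamma>) * (norm (g x))\<^sup>2 + (u x)\<^sup>2 / norm x powr \<gamma>)"
proof -
  \<comment> \<open>The bound 2 - \<gamma> makes the weights to be estimated bounded multiples of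
    those with exponent \<epsilon>; the value 1/2 secures \<epsilon> < 1 when \<gamma> \<le>
    1.\<close>
  define \<epsilon> where "\<epsilon> = min (2 - \<gamma>) (1 / 2)"
  have \<epsilon>: "0 < \<epsilon>" "\<epsilon> < 1" "\<epsilon> \<le> 2 - \<gamma>" using \<open>\<gamma> < 2\<close> by (auto simp: \<epsilon>_def)
  show ?thesis
  proof (rule hardy_inequality_H10[OF assms(1,3,4,5) \<epsilon>(1,2)])
    fix c C :: real
    assume cC: "c > 0" "C > 0" and H:
      "\<And>u g. u \<in> H10 \<Omega> \<Longrightarrow> has_weak_gradient \<Omega> u g \<Longrightarrow>
        u \<in> L2 \<Omega> \<and> g \<in> L2 \<Omega> \<and>
        integrable (lebesgue_on \<Omega>) (\<lambda>x. norm x powr \<epsilon> * (norm (g x))\<^sup>2) \<and>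
        integrable (lebesgue_on \<Omega>) (\<lambda>x. (u x)\<^sup>2 / (norm x)\<^sup>2) \<and>
        integrable (lebesgue_on \<Omega>) (\<lambda>x. norm x powr \<epsilon> * ((u x)\<^sup>2 / (norm x)\<^sup>2)) \<and>
        (real DIM('a))\<^sup>2 / 4 * (LINT x|lebesgue_on \<Omega>. (u x)\<^sup>2 / (norm x)\<^sup>2)
          + \<epsilon> / 8 * (LINT x|lebesgue_on \<Omega>. norm x powr \<epsilon> * ((u x)\<^sup>2 / (norm x)\<^sup>2))
          + c * (LINT x|lebesgue_on \<Omega>. norm x powr \<epsilon> * (norm (g x))\<^sup>2)
        \<le> C * (LINT x|lebesgue_on \<Omega>. (u x)\<^sup>2) + (LINT x|lebesgue_on \<Omega>. (norm (g x))\<^sup>2)"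
    obtain Dm where Dm: "Dm > 0" "\<And>x. x \<in> \<Omega> \<Longrightarrow> norm x \<le> Dm"
      using \<open>bounded \<Omega>\<close> bounded_pos by blast
    define S where "S = Dm powr (2 - \<gamma> - \<epsilon>)"
    have S: "S > 0" using Dm by (simp add: S_def)
    have "0 \<notin> \<Omega>" using assms(1,5) by (simp add: frontier_def interior_open)
    then have n0: "norm x > 0" if "x \<in> \<Omega>" for x using that by auto
    have mO: "\<Omega> \<in> sets lebesgue" using assms(1) by simp
    \<comment> \<open>Both weights of the claim differ from the available ones by this same factor,
      which is at most \<open>S\<close> because \<Omega> is bounded and the exponent is
      nonnegative.\<close>
    define \<kappa> where "\<kappa> = (\<lambda>x::'a. norm x powr (2 - \<gamma> - \<epsilon>))"
    have \<kappa>S: "\<bar>\<kappa> x\<bar> \<le> S" if "x \<in> \<Omega>" for x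
      using Dm(2)[OF that] \<epsilon>(3) by (auto simp: \<kappa>_def S_def intro: powr_mono2)
    have "continuous_on \<Omega> \<kappa>"
      unfolding \<kappa>_def using n0 by (intro continuous_intros) force+
    then have \<kappa>m: "\<kappa> \<in> borel_measurable (lebesgue_on \<Omega>)"
      using mO by (rule continuous_imp_measurable_on_sets_lebesgue)
    have e1: "norm x powr (2 - \<gamma>) = \<kappa> x * norm x powr \<epsilon>" for x :: 'a
      by (simp add: \<kappa>_def powr_add[symmetric])
    have e2: "t / norm x powr \<gamma> = \<kappa> x * (norm x powr \<epsilon> * (t / (norm x)\<^sup>2))" if "x \<in> \<Omega>" for x :: 'a and t
    proof -
      have "norm x powr \<gamma> * norm x powr (2 - \<gamma>) = (norm x)\<^sup>2"
        using n0[OF that] by (simp add: powr_add[symmetric])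
      then have "1 / norm x powr \<gamma> = norm x powr (2 - \<gamma>) / (norm x)\<^sup>2"
        using n0[OF that] by (simp add: field_simps)
      then show ?thesis by (simp add: e1 divide_inverse mult_ac)
    qed
    \<comment> \<open>One coefficient below both surplus terms; dividing by \<open>S\<close> gives
      the constant C3, while C2 is the \<open>C\<close> of the Hardy inequality.\<close>
    define k where "k = min c (\<epsilon> / 8)"
    have k: "k > 0" "k \<le> c" "k \<le> \<epsilon> / 8" using cC \<epsilon> by (auto simp: k_def)
    show ?thesis
    proof (rule exI[of _ C], intro conjI cC(2), rule exI[of _ "k / S"], intro conjI ballI allI impI)
      show "k / S > 0" using k S by simp
      fix u g assume u: "u \<in> H10 \<Omega>" and g: "has_weak_gradient \<Omega> u g"
      let ?M = "lebesgue_on \<Omega>"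
      note h = H[OF u g]
      have g2: "integrable ?M (\<lambda>x. (norm (g x))\<^sup>2)" using h by (simp add: L2_def)
      have i1: "integrable ?M (\<lambda>x. norm x powr \<epsilon> * (norm (g x))\<^sup>2)"
        and i2: "integrable ?M (\<lambda>x. (u x)\<^sup>2 / (norm x)\<^sup>2)"
        and i3: "integrable ?M (\<lambda>x. norm x powr \<epsilon> * ((u x)\<^sup>2 / (norm x)\<^sup>2))" using h by blast+
      show "integrable ?M (\<lambda>x. (norm (g x))\<^sup>2 - \<mu> * ((u x)\<^sup>2 / (norm x)\<^sup>2))"
        by (intro Bochner_Integration.integrable_diff g2 integrable_mult_right i2)
      have \<kappa>b: "\<And>x. x \<in> space ?M \<Longrightarrow> \<bar>\<kappa> x\<bar> \<le> S" using \<kappa>S by simp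
      let ?f = "\<lambda>x. norm x powr \<epsilon> * (norm (g x))\<^sup>2 + norm x powr \<epsilon> * ((u x)\<^sup>2 / (norm x)\<^sup>2)"
      have fi: "integrable ?M ?f" using i1 i3 by (rule Bochner_Integration.integrable_add)
      have eq: "norm x powr (2 - \<gamma>) * (norm (g x))\<^sup>2 + (u x)\<^sup>2 / norm x powr \<gamma> = \<kappa> x * ?f x" if "x \<in> \<Omega>" for x
        unfolding e1 e2[OF that] by (simp add: distrib_left)
      have \<kappa>i: "integrable ?M (\<lambda>x. \<kappa> x * ?f x)"
        by (rule integrable_bounded_mult[OF fi \<kappa>m \<kappa>b])
      then show "integrable ?M (\<lambda>x. norm x powr (2 - \<gamma>) * (norm (g x))\<^sup>2 + (u x)\<^sup>2 / norm x powr \<gamma>)"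
        by (subst Bochner_Integration.integrable_cong[OF refl eq]) auto
      have "k / S * (LINT x|?M. norm x powr (2 - \<gamma>) * (norm (g x))\<^sup>2 + (u x)\<^sup>2 / norm x powr \<gamma>)
          = k / S * (LINT x|?M. \<kappa> x * ?f x)"
        by (subst Bochner_Integration.integral_cong[OF refl eq]) auto
      also have "\<dots> \<le> k / S * (LINT x|?M. S * ?f x)"
      proof (rule mult_left_mono)
        show "(LINT x|?M. \<kappa> x * ?f x) \<le> (LINT x|?M. S * ?f x)"
        proof (rule integral_mono[OF \<kappa>i integrable_mult_right[OF fi]])
          fix x assume "x \<in> space ?M"
          then show "\<kappa> x * ?f x \<le> S * ?f x"
            using \<kappa>b[of x] by (intro mult_right_mono) auto
        qed
      qed (use k S in simp)
      also have "\<dots> = k * (LINT x|?M. ?f x)" using S by simp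
      also have "\<dots> = k * (LINT x|?M. norm x powr \<epsilon> * (norm (g x))\<^sup>2)
          + k * (LINT x|?M. norm x powr \<epsilon> * ((u x)\<^sup>2 / (norm x)\<^sup>2))"
        unfolding Bochner_Integration.integral_add[OF i1 i3] by (rule distrib_left)
      also have "\<dots> \<le> c * (LINT x|?M. norm x powr \<epsilon> * (norm (g x))\<^sup>2)
          + \<epsilon> / 8 * (LINT x|?M. norm x powr \<epsilon> * ((u x)\<^sup>2 / (norm x)\<^sup>2))"
        using k by (intro add_mono mult_right_mono integral_nonneg_AE) auto
      also have "\<dots> \<le> C * (LINT x|?M. (u x)\<^sup>2) + ((LINT x|?M. (norm (g x))\<^sup>2)
          - (real DIM('a))\<^sup>2 / 4 * (LINT x|?M. (u x)\<^sup>2 / (norm x)\<^sup>2))"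
        using h by linarith
      also have "\<dots> \<le> C * (LINT x|?M. (u x)\<^sup>2) + ((LINT x|?M. (norm (g x))\<^sup>2)
          - \<mu> * (LINT x|?M. (u x)\<^sup>2 / (norm x)\<^sup>2))"
        using assms(6) by (intro add_left_mono diff_left_mono mult_right_mono integral_nonneg_AE) auto
      also have "(LINT x|?M. (norm (g x))\<^sup>2) - \<mu> * (LINT x|?M. (u x)\<^sup>2 / (norm x)\<^sup>2)
          = (LINT x|?M. (norm (g x))\<^sup>2 - \<mu> * ((u x)\<^sup>2 / (norm x)\<^sup>2))"
        by (simp only: Bochner_Integration.integral_diff[OF g2 integrable_mult_right[OF i2]]
            integral_mult_right_zero)
      finally show "C * (LINT x|?M. (u x)\<^sup>2) + (LINT x|?M. (norm (g x))\<^sup>2 - \<mu> * ((u x)\<^sup>2 / (norm x)\<^sup>2))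
        \<ge> k / S * (LINT x|?M. norm x powr (2 - \<gamma>) * (norm (g x))\<^sup>2 + (u x)\<^sup>2 / norm x powr \<gamma>)" .
    qed
  qed
qed

end
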